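(* Let $E$ be a compact Polish space, $\alpha$ a probability measure on $E$, $\Phi:E\times E\to\mathbb{R}$ a bounded, measurable, symmetric function, and $W$ a random variable with values in $E'=(0,\infty)$, law $P$ and $\mathbb{E}[W^2]<\infty$. Let $U(\sigma,\sigma',w,w')=\frac{ww'}{2\,\mathbb{E}[W]}e^{\Phi(\sigma,\sigma')}$. Then the maximizer $\nu$ of $$\nu\mapsto \nu\otimes\nu(U)-\int P(dw)\,S(\nu^w\mid\alpha)$$ over all $\nu\in\mathcal{M}_1(E\times E')$ with $\nu(dw)=P(dw)$ (i.e. any such maximizer) is of the form, for $P$-a.e. $w$, $$\frac{d\nu^w}{d\alpha}(\sigma)=\frac{\exp(wV(\sigma))}{\int \alpha(d\tilde\sigma)\exp(wV(\tilde\sigma))},$$ where $V:E\to\mathbb{R}$ satisfies $$V(\sigma)=\int P^{sb}(dw)\,\frac{\int\alpha(d\tilde\sigma)\,e^{\Phi(\sigma,\tilde\sigma)}\exp(wV(\tilde\sigma))}{\int\alpha(d\tilde\sigma)\exp(wV(\tilde\sigma))}.$$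
   Context: $\mathcal{M}_1(X)$ is the set of Borel probability measures on $X$. For $\nu\in\mathcal{M}_1(E\times E')$, $\nu(dw)$ is its marginal on $E'$ and $\nu^w$ the conditional distribution of $\sigma$ given $w$. $\nu\otimes\nu(U)=\int\int U(\sigma,\sigma',w,w')\,\nu(d\sigma,dw)\,\nu(d\sigma',dw')$. $S(\rho\mid\alpha)=\int\rho(d\sigma)\log\frac{d\rho}{d\alpha}(\sigma)$ is relative entropy ($+\infty$ if $\rho\not\ll\alpha$). $P^{sb}$ is the size-biased law $P^{sb}(dw)=\frac{w}{\mathbb{E}[W]}P(dw)$. *)

theory Defs
  imports "HOL-Probability.Probability"
begin

definition borel_prob_measures :: "'a::topological_space set \<Rightarrow> 'a measure set" where
  "borel_prob_measures X = {M. prob_space M \<and> sets M = sets (restrict_space borel X)}"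

abbreviation pos_borel :: "real measure" where
  "pos_borel \<equiv> restrict_space borel {0<..}"

text \<open>\<open>S(\<rho> | \<alpha>)\<close>; the natural logarithm is \<open>log (exp 1)\<close>, and
  \<open>KL_divergence b \<alpha> \<rho>\<close> is the integral of \<open>log b (d\<rho>/d\<alpha>)\<close> against \<open>\<rho>\<close>.
  For probability measures the negative part of \<open>log (d\<rho>/d\<alpha>)\<close> is always \<open>\<rho>\<close>-integrable
  (\<open>x log x \<ge> -1/e\<close>), so a failure of integrability means that the integral is \<open>+\<infinity>\<close>;
  and the divergence is nonnegative, so nothing is truncated by \<open>ennreal\<close>.\<close>

definition relative_entropy :: "'a measure \<Rightarrow> 'a measure \<Rightarrow> ennreal" where
  "relative_entropy \<rho> \<alpha> =
     (if absolutely_continuous \<alpha> \<rho> \<and> integrable \<rho> (entropy_density (exp 1) \<alpha> \<rho>)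
      then ennreal (KL_divergence (exp 1) \<alpha> \<rho>) else \<infinity>)"

definition weight_marginal :: "('a \<times> real) measure \<Rightarrow> real measure" where
  "weight_marginal \<nu> = distr \<nu> pos_borel snd"

text \<open>\<open>\<kappa>\<close> is a version of the conditional distribution \<open>w \<mapsto> \<nu>\<^sup>w\<close> of the first coordinate given
  the second one.\<close>

definition is_cond_distribution ::
    "('a::topological_space \<times> real) measure \<Rightarrow> (real \<Rightarrow> 'a measure) \<Rightarrow> bool" where
  "is_cond_distribution \<nu> \<kappa> \<longleftrightarrow>
     \<kappa> \<in> measurable pos_borel (prob_algebra borel) \<and>
     (\<forall>A\<in>sets borel. \<forall>B\<in>sets pos_borel.
        emeasure \<nu> (A \<times> B) = (\<integral>\<^sup>+ w\<in>B. emeasure (\<kappa> w) A \<partial>weight_marginal \<nu>))"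

text \<open>An arbitrary version of \<open>\<nu>\<^sup>w\<close>. On a Polish space versions exist and any two agree for almost
  every \<open>w\<close>, so the choice does not affect integrals over \<open>w\<close>.\<close>

definition cond_distribution ::
    "('a::topological_space \<times> real) measure \<Rightarrow> real \<Rightarrow> 'a measure" where
  "cond_distribution \<nu> = (SOME \<kappa>. is_cond_distribution \<nu> \<kappa>)"

text \<open>In the following definitions \<open>m\<close> is the mean \<open>E[W]\<close>.\<close>

definition interaction ::
    "real \<Rightarrow> ('a \<Rightarrow> 'a \<Rightarrow> real) \<Rightarrow> 'a \<Rightarrow> 'a \<Rightarrow> real \<Rightarrow> real \<Rightarrow> real" where
  "interaction m \<Phi> \<sigma> \<sigma>' w w' = w * w' / (2 * m) * exp (\<Phi> \<sigma> \<sigma>')"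

definition size_biased :: "real \<Rightarrow> real measure \<Rightarrow> real measure" where
  "size_biased m P = density P (\<lambda>w. ennreal (w / m))"

text \<open>\<open>\<nu> \<otimes> \<nu>(U)\<close> as the iterated integral; the Bochner integrals are finite whenever \<open>U\<close> is the
  interaction of a bounded measurable \<open>\<Phi>\<close> and the weight marginal of \<open>\<nu>\<close> has finite mean.\<close>

definition pair_energy ::
    "('a \<times> real) measure \<Rightarrow> ('a \<Rightarrow> 'a \<Rightarrow> real \<Rightarrow> real \<Rightarrow> real) \<Rightarrow> real" where
  "pair_energy \<nu> U = (\<integral>(\<sigma>, w). (\<integral>(\<sigma>', w'). U \<sigma> \<sigma>' w w' \<partial>\<nu>) \<partial>\<nu>)"

definition objective ::
    "real measure \<Rightarrow> 'a::topological_space measure \<Rightarrow> ('a \<Rightarrow> 'a \<Rightarrow> real \<Rightarrow> real \<Rightarrow> real) \<Rightarrow>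
     ('a \<times> real) measure \<Rightarrow> ereal" where
  "objective P \<alpha> U \<nu> =
     ereal (pair_energy \<nu> U)
       - enn2ereal (\<integral>\<^sup>+ w. relative_entropy (cond_distribution \<nu> w) \<alpha> \<partial>P)"

definition admissible :: "real measure \<Rightarrow> ('a::topological_space \<times> real) measure set" where
  "admissible P = {\<nu> \<in> borel_prob_measures (UNIV \<times> {0<..}). weight_marginal \<nu> = P}"

definition is_maximizer ::
    "real measure \<Rightarrow> 'a::topological_space measure \<Rightarrow> ('a \<Rightarrow> 'a \<Rightarrow> real \<Rightarrow> real \<Rightarrow> real) \<Rightarrow>
     ('a \<times> real) measure \<Rightarrow> bool" where
  "is_maximizer P \<alpha> U \<nu> \<longleftrightarrow>
     \<nu> \<in> admissible P \<and> (\<forall>\<nu>'\<in>admissible P. objective P \<alpha> U \<nu>' \<le> objective P \<alpha> U \<nu>)"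

end

theory Submission
  imports Defs
begin

text \<open>Let \<open>\<nu>\<close> be a maximizer and \<open>V\<close> its field, so that its energy is half the integral of
  \<open>w V(\<sigma>)\<close>, and let \<open>\<mu>\<close> be the Gibbs measure with conditional densities proportional to
  \<open>exp (w V)\<close>. The energy is quadratic and the entropy convex, so comparing \<open>\<nu>\<close> with
  \<open>(1 - t) \<nu> + t \<mu>\<close> to first order in \<open>t\<close> shows that \<open>\<mu>\<close> does not exceed \<open>\<nu>\<close> in the functional
  linearized at \<open>\<nu>\<close>, \<open>\<rho> \<mapsto> \<integral>w V d\<rho> - \<integral>P(dw) S(\<rho>\<^sup>w | \<alpha>)\<close>. By the Gibbs variational principle \<open>\<mu>\<close>
  is its unique maximizer, and \<open>\<nu>\<close> falls short of it by \<open>\<integral>P(dw) S(\<nu>\<^sup>w | \<mu>\<^sup>w)\<close>. Hence this integral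
  vanishes and \<open>\<nu> = \<mu>\<close>; the equation for \<open>V\<close> is then its definition.\<close>

section \<open>Relative entropy of densities\<close>

text \<open>The integrand of relative entropy with the linear terms \<open>b - a\<close> added: these cancel between
  probability densities and make the integrand nonnegative, so that it can be integrated in
  \<open>ennreal\<close> without integrability conditions.\<close>

definition entropy_excess :: "real \<Rightarrow> real \<Rightarrow> real" where
  "entropy_excess a b = a * ln a - a * ln b - a + b"

lemma measurable_entropy_excess [measurable]:
  assumes [measurable]: "f \<in> borel_measurable M" "g \<in> borel_measurable M"
  shows "(\<lambda>x. entropy_excess (f x) (g x)) \<in> borel_measurable M"
  unfolding entropy_excess_def by measurable

text \<open>This is \<open>ln x \<le> x - 1\<close> at \<open>x = b / a\<close>, multiplied by
  \<open>a\<close>. At \<open>a = 0\<close> only \<open>b\<close> remains.\<close>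

lemma entropy_excess_nonneg:
  assumes "a \<ge> 0" "b > 0"
  shows "entropy_excess a b \<ge> 0"
proof (cases "a = 0")
  case False
  with assms have a: "a > 0" by simp
  have "ln (b / a) \<le> b / a - 1"
    using a assms by (intro ln_le_minus_one) simp
  hence "a * ln (b / a) \<le> a * (b / a - 1)"
    using a by (intro mult_left_mono) auto
  thus ?thesis
    using a assms by (simp add: entropy_excess_def ln_div algebra_simps)
qed (use assms in \<open>simp add: entropy_excess_def\<close>)

text \<open>The equality case of \<open>ln x \<le> x - 1\<close>. It later turns vanishing entropy
  relative to the Gibbs density into equality of densities.\<close>

lemma entropy_excess_eq_0:
  assumes "a \<ge> 0" "b > 0" "entropy_excess a b = 0"
  shows "a = b"
proof (cases "a = 0")
  case True
  with assms show ?thesis by (simp add: entropy_excess_def)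
next
  case False
  with assms have a: "a > 0" by simp
  have "a * ln (b / a) = a * (b / a - 1)"
    using assms a by (simp add: entropy_excess_def ln_div algebra_simps)
  hence "ln (b / a) = b / a - 1"
    using a by simp
  hence "b / a = 1"
    using a assms by (intro ln_eq_minus_one) auto
  thus ?thesis using a by simp
qed

text \<open>Taken relative to the mixture \<open>c\<close> instead of 1, both excesses are
  nonnegative, and their weighted mean is exactly the convexity gap, because the terms in
  \<open>ln c\<close> add up to \<open>c * ln c\<close>.\<close>

lemma entropy_excess_convex:
  assumes "a \<ge> 0" "b \<ge> 0" "0 < t" "t < 1"
  shows "entropy_excess ((1 - t) * a + t * b) 1
    \<le> (1 - t) * entropy_excess a 1 + t * entropy_excess b 1"
proof (cases "a = 0 \<and> b = 0")
  case True
  thus ?thesis by (simp add: entropy_excess_def)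
next
  case False
  define c where "c = (1 - t) * a + t * b"
  have "c > 0"
    using False assms unfolding c_def
    by (metis add_nonneg_pos add_pos_nonneg diff_gt_0_iff_gt less_eq_real_def
        mult_nonneg_nonneg mult_pos_pos)
  hence "0 \<le> (1 - t) * entropy_excess a c + t * entropy_excess b c"
    using assms by (intro add_nonneg_nonneg mult_nonneg_nonneg entropy_excess_nonneg) auto
  also have "\<dots> = (1 - t) * entropy_excess a 1 + t * entropy_excess b 1 - entropy_excess c 1"
  proof -
    have "c * ln c = (1 - t) * a * ln c + t * b * ln c"
      by (simp add: c_def algebra_simps)
    thus ?thesis by (simp add: entropy_excess_def c_def algebra_simps)
  qed
  finally show ?thesis by (simp add: c_def)
qed

text \<open>A probability density integrates to one, so the linear terms in
  \<open>entropy_excess\<close> cancel. They are integrable, so a divergent entropy gives the value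
  infinity on both sides.\<close>

lemma relative_entropy_density:
  fixes f :: "'a \<Rightarrow> real"
  assumes "prob_space M" and f [measurable]: "f \<in> borel_measurable M"
    and f_nonneg: "\<And>x. 0 \<le> f x" and f_prob: "prob_space (density M f)"
  shows "relative_entropy (density M f) M = (\<integral>\<^sup>+ x. ennreal (entropy_excess (f x) 1) \<partial>M)"
proof -
  interpret prob_space M by fact
  let ?N = "density M (\<lambda>x. ennreal (f x))"
  have "(\<integral>\<^sup>+ x. ennreal (f x) \<partial>M) = emeasure ?N (space M)"
    by (simp add: emeasure_density cong: nn_integral_cong)
  also have "\<dots> = 1"
    using prob_space.emeasure_space_1[OF f_prob] by simp
  finally have f1: "(\<integral>\<^sup>+ x. ennreal (f x) \<partial>M) = 1" .
  have int_f: "integrable M f"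
    using f_nonneg f1 by (intro integrableI_nonneg) auto
  have lint_f: "(\<integral>x. f x \<partial>M) = 1"
    using f1 f_nonneg by (subst integral_eq_nn_integral) auto
  have ac: "absolutely_continuous M ?N"
    by (rule absolutely_continuousI_density) simp
  have [measurable]: "entropy_density (exp 1) M ?N \<in> borel_measurable M"
    by (auto simp: comp_def entropy_density_def)
  \<comment> \<open>\<open>entropy_density\<close> is built on the version \<open>RN_deriv\<close>,
    which is known to agree with \<open>f\<close> only almost everywhere.\<close>
  have "AE x in M. ennreal (f x) = RN_deriv M ?N x"
    by (rule RN_deriv_unique) auto
  hence ed: "AE x in M. f x * entropy_density (exp 1) M ?N x = f x * ln (f x)"
  proof eventually_elim
    case (elim x)
    hence "enn2real (RN_deriv M ?N x) = f x"
      using f_nonneg by (metis enn2real_ennreal)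
    thus ?case by (simp add: entropy_density_def log_def)
  qed
  have "integrable ?N (entropy_density (exp 1) M ?N) \<longleftrightarrow>
      integrable M (\<lambda>x. f x * entropy_density (exp 1) M ?N x)"
    using f_nonneg by (subst integrable_real_density) auto
  also have "\<dots> \<longleftrightarrow> integrable M (\<lambda>x. f x * ln (f x))"
    by (intro integrable_cong_AE ed) measurable
  finally have iff1: "integrable ?N (entropy_density (exp 1) M ?N) \<longleftrightarrow>
      integrable M (\<lambda>x. f x * ln (f x))" .
  have iff2: "integrable M (\<lambda>x. f x * ln (f x)) \<longleftrightarrow> integrable M (\<lambda>x. entropy_excess (f x) 1)"
  proof
    assume "integrable M (\<lambda>x. f x * ln (f x))"
    thus "integrable M (\<lambda>x. entropy_excess (f x) 1)"
      using int_f by (simp add: entropy_excess_def)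
  next
    assume "integrable M (\<lambda>x. entropy_excess (f x) 1)"
    hence "integrable M (\<lambda>x. entropy_excess (f x) 1 + f x - 1)"
      using int_f by simp
    thus "integrable M (\<lambda>x. f x * ln (f x))" by (simp add: entropy_excess_def)
  qed
  have nn: "AE x in M. 0 \<le> entropy_excess (f x) 1"
    using f_nonneg by (auto intro!: entropy_excess_nonneg)
  show ?thesis
  proof (cases "integrable M (\<lambda>x. f x * ln (f x))")
    case True
    have "KL_divergence (exp 1) M ?N = (\<integral>x. f x * ln (f x) \<partial>M)"
      using f_nonneg by (subst KL_density) (auto simp: log_def)
    also have "\<dots> = (\<integral>x. entropy_excess (f x) 1 \<partial>M)"
      using True int_f lint_f by (simp add: entropy_excess_def prob_space)
    finally show ?thesis
      using True iff1 iff2 ac nn by (simp add: relative_entropy_def nn_integral_eq_integral)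
  next
    case False
    have "(\<lambda>x. entropy_excess (f x) 1) \<in> borel_measurable M"
      by measurable
    hence "\<not> (\<integral>\<^sup>+ x. ennreal (entropy_excess (f x) 1) \<partial>M) < \<infinity>"
      using False iff2 integrableI_nonneg[OF _ nn] by blast
    hence "(\<integral>\<^sup>+ x. ennreal (entropy_excess (f x) 1) \<partial>M) = \<infinity>"
      by (simp only: infinity_ennreal_def less_top[symmetric] not_not)
    thus ?thesis
      using False iff1 by (simp add: relative_entropy_def)
  qed
qed

section \<open>Conditional distributions and joint densities\<close>

text \<open>Admissible measures live on the restricted Borel algebra of the product, whereas Fubini
  and densities use the product algebra. With countable bases the Borel algebra of a product is the
  product of the Borel algebras; the identity, written \<open>(fst x, snd x)\<close>, is then
  measurable both ways.\<close>

lemma sets_restrict_borel_prod: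
  "sets (restrict_space borel (UNIV \<times> {0<..}) :: ('a::second_countable_topology \<times> real) measure)
    = sets (borel \<Otimes>\<^sub>M pos_borel)"
proof (intro subset_antisym subsetI)
  fix A :: "('a \<times> real) set"
  assume "A \<in> sets (restrict_space borel (UNIV \<times> {0<..}))"
  then obtain S :: "('a \<times> real) set" where "S \<in> sets borel" and A: "A = (UNIV \<times> {0<..}) \<inter> S"
    by (auto simp: sets_restrict_space)
  hence S: "S \<in> sets (borel \<Otimes>\<^sub>M borel)"
    unfolding borel_prod by simp
  have "(\<lambda>x. (fst x, snd x)) \<in> (borel :: 'a measure) \<Otimes>\<^sub>M pos_borel \<rightarrow>\<^sub>M borel \<Otimes>\<^sub>M borel"
    by (intro measurable_Pair measurable_fst measurable_compose[OF measurable_snd]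
        measurable_restrict_space1 measurable_ident_sets refl)
  from measurable_sets[OF this S] show "A \<in> sets (borel \<Otimes>\<^sub>M pos_borel)"
    by (simp add: A space_pair_measure Int_commute)
next
  fix A :: "('a \<times> real) set"
  assume A: "A \<in> sets (borel \<Otimes>\<^sub>M pos_borel)"
  let ?R = "restrict_space borel (UNIV \<times> {0<..}) :: ('a \<times> real) measure"
  have "(\<lambda>x. (fst x, snd x)) \<in> ?R \<rightarrow>\<^sub>M borel \<Otimes>\<^sub>M pos_borel"
  proof (intro measurable_Pair measurable_restrict_space2)
    show "fst \<in> ?R \<rightarrow>\<^sub>M borel" "snd \<in> ?R \<rightarrow>\<^sub>M borel"
      by (auto intro!: measurable_restrict_space1 simp: borel_prod[symmetric])
  qed (auto simp: space_restrict_space)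
  from measurable_sets[OF this A] show "A \<in> sets ?R"
    using sets.sets_into_space[OF A]
    by (simp add: space_pair_measure space_restrict_space Int_absorb2)
qed

text \<open>Finite intersections from a countable basis. Countability lets almost-everywhere
  statements for single sets be combined; stability under intersection makes the family determine a
  finite measure.\<close>

lemma countable_Int_stable_generator:
  obtains B :: "'a::second_countable_topology set set"
  where "countable B" "Int_stable B" "UNIV \<in> B" "B \<subseteq> sets borel"
    "sets (borel :: 'a measure) = sigma_sets UNIV B"
proof -
  obtain C :: "'a set set" where C: "countable C" "topological_basis C"
    using ex_countable_basis by blast
  define B where "B = Inter ` {F. finite F \<and> F \<subseteq> C}"
  have openC: "open X" if "X \<in> C" for X
    using C(2) that by (rule topological_basis_open)
  have open_B: "open X" if "X \<in> B" for X
    using that openC unfolding B_def by (auto intro!: open_Inter)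
  have "C \<subseteq> B"
  proof
    fix X assume "X \<in> C"
    thus "X \<in> B" unfolding B_def by (intro image_eqI[of _ _ "{X}"]) auto
  qed
  have cB: "countable B"
    unfolding B_def by (intro countable_image countable_Collect_finite_subset C)
  have "topological_basis B"
    using C(2) \<open>C \<subseteq> B\<close> open_B unfolding topological_basis_def by (meson order_trans)
  hence "(borel :: 'a measure) = sigma UNIV B"
    by (rule borel_eq_countable_basis[OF cB])
  hence "sets (borel :: 'a measure) = sets (sigma UNIV B)"
    by (rule arg_cong[where f = sets])
  also have "\<dots> = sigma_sets UNIV B"
    by (rule sets_measure_of) simp
  finally have "sets (borel :: 'a measure) = sigma_sets UNIV B" .
  moreover have "Int_stable B"
    unfolding Int_stable_def
  proof safe
    fix X Y assume "X \<in> B" "Y \<in> B"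
    then obtain F G where "finite F" "F \<subseteq> C" "X = \<Inter>F" "finite G" "G \<subseteq> C" "Y = \<Inter>G"
      by (auto simp: B_def)
    thus "X \<inter> Y \<in> B" unfolding B_def by (intro image_eqI[of _ _ "F \<union> G"]) auto
  qed
  \<comment> \<open>\<open>UNIV\<close> is the intersection of the empty family.\<close>
  moreover have "UNIV \<in> B"
    unfolding B_def by (intro image_eqI[of _ _ "{}"]) auto
  ultimately show thesis
    using that cB open_B by blast
qed

text \<open>For a fixed set \<open>A\<close> both kernels are densities of the measure
  \<open>B \<mapsto> \<nu> (A \<times> B)\<close> with respect to the marginal, hence agree almost
  everywhere. The countable generator leaves one common exceptional set, and off it the two
  probability measures coincide.\<close>

lemma is_cond_distribution_unique:
  fixes \<nu> :: "('a::second_countable_topology \<times> real) measure"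
  assumes prob: "prob_space (weight_marginal \<nu>)"
    and \<kappa>: "is_cond_distribution \<nu> \<kappa>" and \<kappa>': "is_cond_distribution \<nu> \<kappa>'"
  shows "AE w in weight_marginal \<nu>. \<kappa> w = \<kappa>' w"
proof -
  interpret prob_space "weight_marginal \<nu>" by fact
  let ?P = "weight_marginal \<nu>"
  have sets_P [measurable_cong]: "sets ?P = sets pos_borel"
    by (simp add: weight_marginal_def)
  have space_P: "space ?P = {0<..}"
    by (simp add: weight_marginal_def space_restrict_space)
  have k [measurable]: "\<kappa> \<in> pos_borel \<rightarrow>\<^sub>M prob_algebra borel" "\<kappa>' \<in> pos_borel \<rightarrow>\<^sub>M prob_algebra borel"
    using \<kappa> \<kappa>' by (auto simp: is_cond_distribution_def)
  have k_sp: "prob_space (\<kappa> w)" "sets (\<kappa> w) = sets borel"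
    "prob_space (\<kappa>' w)" "sets (\<kappa>' w) = sets borel" if "w > 0" for w
    using measurable_space[OF k(1), of w] measurable_space[OF k(2), of w] that
    by (auto simp: space_prob_algebra space_restrict_space)
  obtain B :: "'a set set" where B: "countable B" "Int_stable B" "UNIV \<in> B" "B \<subseteq> sets borel"
    "sets (borel :: 'a measure) = sigma_sets UNIV B"
    by (rule countable_Int_stable_generator)
  have "AE w in ?P. emeasure (\<kappa> w) A = emeasure (\<kappa>' w) A" if "A \<in> B" for A
  proof (rule density_unique)
    have A [measurable]: "A \<in> sets borel" using that B by auto
    have [measurable]: "\<kappa> \<in> pos_borel \<rightarrow>\<^sub>M subprob_algebra borel" "\<kappa>' \<in> pos_borel \<rightarrow>\<^sub>M subprob_algebra borel"
      by (auto intro: measurable_prob_algebraD)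
    show m [measurable]: "(\<lambda>w. emeasure (\<kappa> w) A) \<in> borel_measurable ?P"
      "(\<lambda>w. emeasure (\<kappa>' w) A) \<in> borel_measurable ?P"
      by (measurable)
    show "density ?P (\<lambda>w. emeasure (\<kappa> w) A) = density ?P (\<lambda>w. emeasure (\<kappa>' w) A)"
    proof (rule measure_eqI)
      fix X assume "X \<in> sets (density ?P (\<lambda>w. emeasure (\<kappa> w) A))"
      hence X: "X \<in> sets pos_borel" "X \<in> sets ?P" by (auto simp: sets_P)
      thus "emeasure (density ?P (\<lambda>w. emeasure (\<kappa> w) A)) X
          = emeasure (density ?P (\<lambda>w. emeasure (\<kappa>' w) A)) X"
        using \<kappa> \<kappa>' A by (simp add: emeasure_density is_cond_distribution_def)
    qed simp
  qed
  hence "AE w in ?P. \<forall>A\<in>B. emeasure (\<kappa> w) A = emeasure (\<kappa>' w) A"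
    using B(1) by (simp add: AE_ball_countable)
  thus ?thesis
    using AE_space
  proof eventually_elim
    case (elim w)
    hence w: "w > 0" by (simp add: space_P)
    show ?case
    proof (rule measure_eqI_generator_eq_countable[where \<Omega> = UNIV and E = B and A = "{UNIV}"])
      show "emeasure (\<kappa> w) A \<noteq> \<infinity>" for A
        using k_sp(1)[OF w] by (metis emeasure_finite prob_space_def finite_measure.emeasure_finite infinity_ennreal_def)
    qed (use B k_sp[OF w] elim in auto)
  qed
qed

section \<open>Densities with respect to the product of \<open>\<alpha>\<close> and
  \<open>P\<close>\<close>

locale reference_pair =
  fixes \<alpha> :: "'a::second_countable_topology measure" and P :: "real measure"
  assumes prob_alpha: "prob_space \<alpha>" and sets_alpha [measurable_cong]: "sets \<alpha> = sets borel"
    and prob_P: "prob_space P" and sets_P [measurable_cong]: "sets P = sets pos_borel"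
begin

sublocale alpha: prob_space \<alpha> by (fact prob_alpha)
sublocale weight: prob_space P by (fact prob_P)
sublocale pair_prob_space \<alpha> P ..

abbreviation "\<pi> \<equiv> \<alpha> \<Otimes>\<^sub>M P"

lemma space_alpha: "space \<alpha> = UNIV"
  using sets_eq_imp_space_eq[OF sets_alpha] by simp

lemma space_P: "space P = {0<..}"
  using sets_eq_imp_space_eq[OF sets_P] by (simp add: space_restrict_space)

lemma space_pi: "space \<pi> = UNIV \<times> {0<..}"
  by (simp add: space_pair_measure space_alpha space_P)

lemma sets_pi: "sets \<pi> = sets (restrict_space borel (UNIV \<times> {0<..}))"
  unfolding sets_restrict_borel_prod by (intro sets_pair_measure_cong sets_alpha sets_P)

lemma measurable_weight [measurable]: "(\<lambda>w. w) \<in> borel_measurable P"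
  unfolding measurable_cong_sets[OF sets_P refl] by (intro measurable_restrict_space1) auto

lemma emeasure_weight_marginal:
  assumes "sets \<nu> = sets \<pi>" "B \<in> sets P"
  shows "emeasure (weight_marginal \<nu>) B = emeasure \<nu> (UNIV \<times> B)"
proof -
  have [measurable]: "snd \<in> \<nu> \<rightarrow>\<^sub>M pos_borel"
    using assms(1) by (simp cong: measurable_cong_sets)
  have "B \<subseteq> {0<..}"
    using sets.sets_into_space[OF assms(2)] by (simp add: space_P)
  hence "snd -` B \<inter> space \<nu> = UNIV \<times> B"
    using sets_eq_imp_space_eq[OF assms(1)] by (auto simp: space_pi)
  thus ?thesis
    using assms(2) sets_P by (simp add: weight_marginal_def emeasure_distr)
qed

context
  fixes f :: "'a \<times> real \<Rightarrow> real"
  assumes f [measurable]: "f \<in> borel_measurable \<pi>" and f_nonneg: "\<And>x. 0 \<le> f x"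
    and marginal: "weight_marginal (density \<pi> f) = P"
begin

text \<open>By Tonelli the section integrals are a density of the weight marginal with respect to
  \<open>P\<close>; this marginal is \<open>P\<close> itself and so has density 1 as well.\<close>

lemma AE_section_prob: "AE w in P. (\<integral>\<^sup>+ \<sigma>. f (\<sigma>, w) \<partial>\<alpha>) = 1"
proof (rule weight.density_unique)
  show "density P (\<lambda>w. \<integral>\<^sup>+ \<sigma>. f (\<sigma>, w) \<partial>\<alpha>) = density P (\<lambda>_. 1)"
  proof (rule measure_eqI)
    fix B assume "B \<in> sets (density P (\<lambda>w. \<integral>\<^sup>+ \<sigma>. f (\<sigma>, w) \<partial>\<alpha>))"
    hence B [measurable]: "B \<in> sets P" by simp
    have UB [measurable]: "UNIV \<times> B \<in> sets \<pi>"
      using B pair_measureI[of UNIV \<alpha> B P] by (simp add: sets_alpha)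
    have "emeasure (density P (\<lambda>w. \<integral>\<^sup>+ \<sigma>. f (\<sigma>, w) \<partial>\<alpha>)) B
        = (\<integral>\<^sup>+ w. (\<integral>\<^sup>+ \<sigma>. f (\<sigma>, w) \<partial>\<alpha>) * indicator B w \<partial>P)"
      by (subst emeasure_density) auto
    also have "\<dots> = (\<integral>\<^sup>+ w. (\<integral>\<^sup>+ \<sigma>. f (\<sigma>, w) * indicator (UNIV \<times> B) (\<sigma>, w) \<partial>\<alpha>) \<partial>P)"
      by (intro nn_integral_cong) (auto split: split_indicator)
    also have "\<dots> = (\<integral>\<^sup>+ x. f x * indicator (UNIV \<times> B) x \<partial>\<pi>)"
      by (intro nn_integral_snd) measurable
    also have "\<dots> = emeasure (weight_marginal (density \<pi> f)) B"
      by (subst emeasure_weight_marginal) (auto simp: emeasure_density intro!: nn_integral_cong split: split_indicator)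
    also have "\<dots> = emeasure (density P (\<lambda>_. 1)) B"
      by (simp add: marginal density_1)
    finally show "emeasure (density P (\<lambda>w. \<integral>\<^sup>+ \<sigma>. f (\<sigma>, w) \<partial>\<alpha>)) B
      = emeasure (density P (\<lambda>_. 1)) B" .
  qed simp
qed measurable

lemma prob_space_section:
  assumes "(\<integral>\<^sup>+ \<sigma>. f (\<sigma>, w) \<partial>\<alpha>) = 1" "w > 0"
  shows "prob_space (density \<alpha> (\<lambda>\<sigma>. f (\<sigma>, w)))"
proof
  have [measurable]: "w \<in> space P" using assms by (simp add: space_P)
  show "emeasure (density \<alpha> (\<lambda>\<sigma>. f (\<sigma>, w))) (space (density \<alpha> (\<lambda>\<sigma>. f (\<sigma>, w)))) = 1"
    using assms by (simp add: emeasure_density space_alpha)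
qed

text \<open>A kernel must be a probability measure at every \<open>w\<close>, not just at almost
  every one. Where the section of \<open>f\<close> fails to have integral one, the kernel falls back
  on the density 1, that is on \<open>\<alpha>\<close> itself.\<close>

lemma is_cond_distribution_density:
  "is_cond_distribution (density \<pi> f)
     (\<lambda>w. density \<alpha> (\<lambda>\<sigma>. if (\<integral>\<^sup>+ \<tau>. f (\<tau>, w) \<partial>\<alpha>) = 1 then f (\<sigma>, w) else 1))"
  (is "is_cond_distribution _ ?\<kappa>")
  unfolding is_cond_distribution_def marginal
proof (intro conjI ballI)
  \<comment> \<open>Written as an integral over \<open>\<alpha>\<close>, the measure of
    \<open>A\<close> is measurable in \<open>w\<close> by Tonelli.\<close>
  have em: "emeasure (?\<kappa> w) A =
      (\<integral>\<^sup>+ \<sigma>. (if (\<integral>\<^sup>+ \<tau>. f (\<tau>, w) \<partial>\<alpha>) = 1 then f (\<sigma>, w) else 1) * indicator A \<sigma> \<partial>\<alpha>)"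
    if "w > 0" "A \<in> sets borel" for w A
  proof -
    have [measurable]: "w \<in> space P" "A \<in> sets \<alpha>"
      using that by (simp_all add: space_P sets_alpha)
    show ?thesis by (subst emeasure_density) (auto intro!: nn_integral_cong split: split_indicator)
  qed
  show "?\<kappa> \<in> pos_borel \<rightarrow>\<^sub>M prob_algebra borel"
  proof (intro measurable_prob_algebraI measurable_subprob_algebra)
    fix w :: real assume "w \<in> space pos_borel"
    hence w: "w > 0" by (simp add: space_restrict_space)
    show p: "prob_space (?\<kappa> w)"
      using prob_space_section[OF _ w] prob_alpha
      by (cases "(\<integral>\<^sup>+ \<tau>. f (\<tau>, w) \<partial>\<alpha>) = 1") (auto simp: density_1)
    thus "subprob_space (?\<kappa> w)" by (rule prob_space_imp_subprob_space)
  next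
    fix A :: "'a set" assume A [measurable]: "A \<in> sets borel"
    have "(\<lambda>w. \<integral>\<^sup>+ \<sigma>. (if (\<integral>\<^sup>+ \<tau>. f (\<tau>, w) \<partial>\<alpha>) = 1 then f (\<sigma>, w) else 1) * indicator A \<sigma> \<partial>\<alpha>)
        \<in> borel_measurable P"
      by measurable
    hence "(\<lambda>w. \<integral>\<^sup>+ \<sigma>. (if (\<integral>\<^sup>+ \<tau>. f (\<tau>, w) \<partial>\<alpha>) = 1 then f (\<sigma>, w) else 1) * indicator A \<sigma> \<partial>\<alpha>)
        \<in> borel_measurable pos_borel"
      by (simp cong: measurable_cong_sets)
    thus "(\<lambda>w. emeasure (?\<kappa> w) A) \<in> borel_measurable pos_borel"
      by (rule measurable_cong[THEN iffD2, rotated]) (rule em, auto simp: space_restrict_space)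
  qed (simp add: sets_alpha)
  fix A :: "'a set" and B :: "real set"
  assume A [measurable]: "A \<in> sets borel" and "B \<in> sets pos_borel"
  hence B [measurable]: "B \<in> sets P" by (simp add: sets_P)
  have AB [measurable]: "A \<times> B \<in> sets \<pi>"
    using A B pair_measureI[of A \<alpha> B P] by (simp add: sets_alpha)
  have "emeasure (density \<pi> f) (A \<times> B) = (\<integral>\<^sup>+ x. f x * indicator (A \<times> B) x \<partial>\<pi>)"
    by (subst emeasure_density) (auto intro!: nn_integral_cong split: split_indicator)
  also have "\<dots> = (\<integral>\<^sup>+ w. (\<integral>\<^sup>+ \<sigma>. f (\<sigma>, w) * indicator (A \<times> B) (\<sigma>, w) \<partial>\<alpha>) \<partial>P)"
    by (intro nn_integral_snd[symmetric]) measurable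
  also have "(\<integral>\<^sup>+ w. (\<integral>\<^sup>+ \<sigma>. f (\<sigma>, w) * indicator (A \<times> B) (\<sigma>, w) \<partial>\<alpha>) \<partial>P)
      = (\<integral>\<^sup>+ w\<in>B. emeasure (?\<kappa> w) A \<partial>P)"
  proof (rule nn_integral_cong_AE)
    show "AE w in P. (\<integral>\<^sup>+ \<sigma>. f (\<sigma>, w) * indicator (A \<times> B) (\<sigma>, w) \<partial>\<alpha>)
      = emeasure (?\<kappa> w) A * indicator B w"
    using AE_section_prob AE_space
  proof eventually_elim
    case (elim w)
    hence "w > 0" by (simp add: space_P)
    thus ?case
      using elim(1) em[of w A] by (cases "w \<in> B") (auto simp: indicator_def intro!: nn_integral_cong)
  qed
  qed
  finally show "emeasure (density \<pi> f) (A \<times> B) = (\<integral>\<^sup>+ w\<in>B. emeasure (?\<kappa> w) A \<partial>P)" .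
qed

text \<open>Versions are unique, and the fallback density 1 is used only on a null set of
  weights.\<close>

lemma AE_cond_distribution:
  assumes "is_cond_distribution (density \<pi> f) \<kappa>"
  shows "AE w in P. \<kappa> w = density \<alpha> (\<lambda>\<sigma>. f (\<sigma>, w))"
proof -
  have "AE w in P. \<kappa> w = density \<alpha> (\<lambda>\<sigma>. if (\<integral>\<^sup>+ \<tau>. f (\<tau>, w) \<partial>\<alpha>) = 1 then f (\<sigma>, w) else 1)"
    using is_cond_distribution_unique[OF _ assms is_cond_distribution_density] prob_P
    unfolding marginal by blast
  thus ?thesis
    using AE_section_prob by eventually_elim simp
qed

text \<open>The formula for densities on almost every fibre, followed by Tonelli. The entropy term
  of the objective becomes one integral of the joint density, whichever version
  \<open>cond_distribution\<close> has picked.\<close>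

lemma nn_integral_relative_entropy:
  "(\<integral>\<^sup>+ w. relative_entropy (cond_distribution (density \<pi> f) w) \<alpha> \<partial>P)
    = (\<integral>\<^sup>+ x. entropy_excess (f x) 1 \<partial>\<pi>)"
proof -
  \<comment> \<open>The explicit version constructed above shows that the choice by
    \<open>SOME\<close> has a witness.\<close>
  have "is_cond_distribution (density \<pi> f) (cond_distribution (density \<pi> f))"
    unfolding cond_distribution_def by (rule someI[of "is_cond_distribution _"]) (rule is_cond_distribution_density)
  hence "AE w in P. cond_distribution (density \<pi> f) w = density \<alpha> (\<lambda>\<sigma>. f (\<sigma>, w))"
    by (rule AE_cond_distribution)
  hence "AE w in P. relative_entropy (cond_distribution (density \<pi> f) w) \<alpha>
      = (\<integral>\<^sup>+ \<sigma>. entropy_excess (f (\<sigma>, w)) 1 \<partial>\<alpha>)"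
    using AE_section_prob AE_space
  proof eventually_elim
    case (elim w)
    hence [measurable]: "w \<in> space P" by simp
    hence "w > 0" by (simp add: space_P)
    thus ?case
      using elim prob_space_section[of w] f_nonneg prob_alpha
      by (subst elim(1), intro relative_entropy_density) auto
  qed
  hence "(\<integral>\<^sup>+ w. relative_entropy (cond_distribution (density \<pi> f) w) \<alpha> \<partial>P)
    = (\<integral>\<^sup>+ w. (\<integral>\<^sup>+ \<sigma>. entropy_excess (f (\<sigma>, w)) 1 \<partial>\<alpha>) \<partial>P)"
    by (rule nn_integral_cong_AE)
  also have "\<dots> = (\<integral>\<^sup>+ x. entropy_excess (f x) 1 \<partial>\<pi>)"
    by (intro nn_integral_snd[where f = "\<lambda>x. ennreal (entropy_excess (f x) 1)"]) measurable
  finally show ?thesis .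
qed

end

text \<open>The definition of a conditional distribution speaks only of rectangles. These generate
  the product algebra and are stable under intersection, so \<open>\<nu>\<close> equals the measure
  \<open>?N\<close> obtained by mixing the fibres \<open>\<kappa> w\<close> over
  \<open>P\<close>.\<close>

lemma emeasure_cond_distribution:
  assumes "prob_space \<nu>" "sets \<nu> = sets \<pi>" "weight_marginal \<nu> = P" "is_cond_distribution \<nu> \<kappa>"
    and "A \<in> sets \<pi>"
  shows "emeasure \<nu> A = (\<integral>\<^sup>+ w. emeasure (\<kappa> w) ((\<lambda>\<sigma>. (\<sigma>, w)) -` A) \<partial>P)"
proof -
  let ?N = "P \<bind> (\<lambda>w. distr (\<kappa> w) \<pi> (\<lambda>\<sigma>. (\<sigma>, w)))"
  have k0: "\<kappa> \<in> pos_borel \<rightarrow>\<^sub>M prob_algebra borel"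
    using assms(4) by (simp add: is_cond_distribution_def)
  hence k: "\<kappa> \<in> P \<rightarrow>\<^sub>M subprob_algebra \<alpha>"
    unfolding measurable_cong_sets[OF sets_P refl] subprob_algebra_cong[OF sets_alpha]
    by (rule measurable_prob_algebraD)
  have sets_k: "sets (\<kappa> w) = sets \<alpha>" if "w \<in> space P" for w
    using measurable_space[OF k that] by (simp add: space_subprob_algebra)
  have kern: "(\<lambda>w. distr (\<kappa> w) \<pi> (\<lambda>\<sigma>. (\<sigma>, w))) \<in> P \<rightarrow>\<^sub>M subprob_algebra \<pi>"
    by (rule measurable_distr2[OF _ k]) measurable
  have ne: "space P \<noteq> {}" by (rule weight.not_empty)
  have em: "emeasure ?N A = (\<integral>\<^sup>+ w. emeasure (\<kappa> w) ((\<lambda>\<sigma>. (\<sigma>, w)) -` A) \<partial>P)"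
    if A: "A \<in> sets \<pi>" for A
  proof -
    have "emeasure ?N A = (\<integral>\<^sup>+ w. emeasure (distr (\<kappa> w) \<pi> (\<lambda>\<sigma>. (\<sigma>, w))) A \<partial>P)"
      by (rule emeasure_bind[OF ne kern A])
    also have "\<dots> = (\<integral>\<^sup>+ w. emeasure (\<kappa> w) ((\<lambda>\<sigma>. (\<sigma>, w)) -` A) \<partial>P)"
    proof (intro nn_integral_cong)
      fix w assume w [measurable]: "w \<in> space P"
      have "(\<lambda>\<sigma>. (\<sigma>, w)) \<in> \<kappa> w \<rightarrow>\<^sub>M \<pi>"
        unfolding measurable_cong_sets[OF sets_k[OF w] refl] by measurable
      thus "emeasure (distr (\<kappa> w) \<pi> (\<lambda>\<sigma>. (\<sigma>, w))) A = emeasure (\<kappa> w) ((\<lambda>\<sigma>. (\<sigma>, w)) -` A)"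
        using A sets_eq_imp_space_eq[OF sets_k[OF w]] by (simp add: emeasure_distr space_alpha)
    qed
    finally show ?thesis .
  qed
  let ?E = "{a \<times> b |a b. a \<in> sets \<alpha> \<and> b \<in> sets P}"
  have "\<nu> = ?N"
  proof (rule measure_eqI_generator_eq_countable[where \<Omega> = "space \<alpha> \<times> space P" and E = ?E
        and A = "{space \<alpha> \<times> space P}"])
    show "Int_stable ?E" by (rule Int_stable_pair_measure_generator)
    show "?E \<subseteq> Pow (space \<alpha> \<times> space P)" by (rule pair_measure_closed)
    show "sets \<nu> = sigma_sets (space \<alpha> \<times> space P) ?E"
      using assms(2) by (simp add: sets_pair_measure)
    show "sets ?N = sigma_sets (space \<alpha> \<times> space P) ?E"
      using sets_bind[OF _ ne, of "\<lambda>w. distr (\<kappa> w) \<pi> (\<lambda>\<sigma>. (\<sigma>, w))" \<pi>]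
      by (simp add: sets_pair_measure)
    show "emeasure \<nu> X \<noteq> \<infinity>" for X
      using assms(1) by (simp add: prob_space_def finite_measure.emeasure_finite)
    fix X assume "X \<in> ?E"
    then obtain A B where X: "X = A \<times> B" "A \<in> sets \<alpha>" "B \<in> sets P" by auto
    have "emeasure ?N X = (\<integral>\<^sup>+ w. emeasure (\<kappa> w) ((\<lambda>\<sigma>. (\<sigma>, w)) -` X) \<partial>P)"
      using X by (intro em) auto
    also have "\<dots> = (\<integral>\<^sup>+ w\<in>B. emeasure (\<kappa> w) A \<partial>P)"
      by (intro nn_integral_cong) (auto simp: X(1) indicator_def vimage_def)
    also have "\<dots> = emeasure \<nu> X"
      using assms(3,4) X by (simp add: is_cond_distribution_def sets_alpha sets_P)
    finally show "emeasure \<nu> X = emeasure ?N X" ..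
  qed auto
  thus ?thesis using em[OF assms(5)] by simp
qed

text \<open>The relative entropy need not be a measurable function of \<open>w\<close> a priori, so finiteness of its
  integral cannot be turned directly into finiteness for almost every \<open>w\<close>; it is tested on the
  measurable set of those \<open>w\<close> at which \<open>\<kappa> w\<close> charges the section of a null set.\<close>

lemma absolutely_continuous_if_finite_entropy:
  assumes \<nu>: "prob_space \<nu>" "sets \<nu> = sets \<pi>" "weight_marginal \<nu> = P" "is_cond_distribution \<nu> \<kappa>"
    and fin: "(\<integral>\<^sup>+ w. relative_entropy (\<kappa> w) \<alpha> \<partial>P) < \<infinity>"
  shows "absolutely_continuous \<pi> \<nu>"
  unfolding absolutely_continuous_def
proof
  fix A assume "A \<in> null_sets \<pi>"
  hence A [measurable]: "A \<in> sets \<pi>" and A0: "emeasure \<pi> A = 0" by auto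
  have k0: "\<kappa> \<in> pos_borel \<rightarrow>\<^sub>M prob_algebra borel"
    using \<nu>(4) by (simp add: is_cond_distribution_def)
  hence k: "\<kappa> \<in> P \<rightarrow>\<^sub>M subprob_algebra \<alpha>"
    unfolding measurable_cong_sets[OF sets_P refl] subprob_algebra_cong[OF sets_alpha]
    by (rule measurable_prob_algebraD)
  let ?s = "\<lambda>w. (\<lambda>\<sigma>. (\<sigma>, w)) -` A"
  have meas [measurable]: "(\<lambda>w. emeasure (\<kappa> w) (?s w)) \<in> borel_measurable P"
  proof (rule emeasure_measurable_subprob_algebra2[OF _ k])
    have "Sigma (space P) ?s = (\<lambda>(w, \<sigma>). (\<sigma>, w)) -` A \<inter> space (P \<Otimes>\<^sub>M \<alpha>)"
      by (auto simp: space_pair_measure space_alpha)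
    also have "\<dots> \<in> sets (P \<Otimes>\<^sub>M \<alpha>)" by measurable
    finally show "Sigma (space P) ?s \<in> sets (P \<Otimes>\<^sub>M \<alpha>)" .
  qed
  have "(\<integral>\<^sup>+ w. emeasure \<alpha> (?s w) \<partial>P) = 0"
    using A0 emeasure_pair_measure_alt2[OF A] by simp
  hence "AE w in P. emeasure \<alpha> (?s w) = 0"
    by (subst (asm) nn_integral_0_iff_AE) (use measurable_emeasure_Pair2[OF A] in auto)
  hence "AE w in P. \<infinity> * indicator {w \<in> space P. emeasure (\<kappa> w) (?s w) \<noteq> 0} w
      \<le> relative_entropy (\<kappa> w) \<alpha>"
    using AE_space
  proof eventually_elim
    case (elim w)
    have "?s w \<in> sets \<alpha>" by (rule sets_Pair2) (rule A)
    hence "absolutely_continuous \<alpha> (\<kappa> w) \<Longrightarrow> emeasure (\<kappa> w) (?s w) = 0"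
      using elim by (auto simp: absolutely_continuous_def null_sets_def)
    thus ?case
      by (auto simp: relative_entropy_def indicator_def)
  qed
  hence "(\<integral>\<^sup>+ w. \<infinity> * indicator {w \<in> space P. emeasure (\<kappa> w) (?s w) \<noteq> 0} w \<partial>P)
      \<le> (\<integral>\<^sup>+ w. relative_entropy (\<kappa> w) \<alpha> \<partial>P)"
    \<comment> \<open>Monotonicity of \<open>nn_integral\<close> asks for no measurability, so the
      entropy may stand on the right as it is.\<close>
    by (rule nn_integral_mono_AE)
  hence "\<infinity> * emeasure P {w \<in> space P. emeasure (\<kappa> w) (?s w) \<noteq> 0} < \<infinity>"
    using fin by (simp add: nn_integral_cmult)
  hence "emeasure P {w \<in> space P. emeasure (\<kappa> w) (?s w) \<noteq> 0} = 0"
    by (auto simp: ennreal_mult_less_top)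
  hence "AE w in P. emeasure (\<kappa> w) (?s w) = 0"
    by (auto intro!: AE_I[OF subset_refl])
  hence "emeasure \<nu> A = 0"
    unfolding emeasure_cond_distribution[OF \<nu> A] by (subst nn_integral_0_iff_AE) auto
  thus "A \<in> null_sets \<nu>"
    using A \<nu>(2) by (auto simp: null_sets_def)
qed

text \<open>Brings a measure of finite entropy into the form on which the later computations run.
  The Radon-Nikodym derivative of a finite measure is finite almost everywhere, so replacing it by
  real values does not change the measure.\<close>

lemma density_if_finite_entropy:
  assumes \<nu>: "prob_space \<nu>" "sets \<nu> = sets \<pi>" "weight_marginal \<nu> = P" "is_cond_distribution \<nu> \<kappa>"
    and fin: "(\<integral>\<^sup>+ w. relative_entropy (\<kappa> w) \<alpha> \<partial>P) < \<infinity>"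
  obtains f :: "'a \<times> real \<Rightarrow> real" where "f \<in> borel_measurable \<pi>" "\<And>x. 0 \<le> f x" "\<nu> = density \<pi> f"
proof -
  interpret \<nu>: prob_space \<nu> by fact
  have ac: "absolutely_continuous \<pi> \<nu>"
    by (rule absolutely_continuous_if_finite_entropy[OF assms])
  have "AE x in \<pi>. RN_deriv \<pi> \<nu> x \<noteq> \<infinity>"
    by (intro RN_deriv_finite ac \<nu>(2) \<nu>.sigma_finite_measure_axioms)
  hence "density \<pi> (\<lambda>x. ennreal (enn2real (RN_deriv \<pi> \<nu> x))) = density \<pi> (RN_deriv \<pi> \<nu>)"
    by (intro density_cong) (auto simp: less_top)
  also have "\<dots> = \<nu>" by (rule density_RN_deriv[OF ac \<nu>(2)])
  finally show thesis
    by (intro that[of "\<lambda>x. enn2real (RN_deriv \<pi> \<nu> x)"]) auto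
qed

end

section \<open>Admissible measures given by densities\<close>

context reference_pair
begin

lemma measurable_weight_snd [measurable]: "snd \<in> borel_measurable (N \<Otimes>\<^sub>M P)"
  using measurable_compose[OF measurable_snd measurable_weight, of N] by simp

lemma measurable_weight_fst [measurable]: "fst \<in> borel_measurable (P \<Otimes>\<^sub>M N)"
  using measurable_compose[OF measurable_fst measurable_weight, of N] by simp

lemma admissible_iff:
  "\<nu> \<in> admissible P \<longleftrightarrow> prob_space \<nu> \<and> sets \<nu> = sets \<pi> \<and> weight_marginal \<nu> = P"
  by (auto simp: admissible_def borel_prob_measures_def sets_pi)

lemma weight_marginal_density_iff:
  fixes f :: "'a \<times> real \<Rightarrow> real"
  assumes f [measurable]: "f \<in> borel_measurable \<pi>" and f_nonneg: "\<And>x. 0 \<le> f x"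
  shows "weight_marginal (density \<pi> f) = P \<longleftrightarrow> (AE w in P. (\<integral>\<^sup>+ \<sigma>. f (\<sigma>, w) \<partial>\<alpha>) = 1)"
proof
  assume "weight_marginal (density \<pi> f) = P"
  with assms show "AE w in P. (\<integral>\<^sup>+ \<sigma>. f (\<sigma>, w) \<partial>\<alpha>) = 1" by (rule AE_section_prob)
next
  assume ae: "AE w in P. (\<integral>\<^sup>+ \<sigma>. f (\<sigma>, w) \<partial>\<alpha>) = 1"
  show "weight_marginal (density \<pi> f) = P"
  proof (rule measure_eqI)
    show s: "sets (weight_marginal (density \<pi> f)) = sets P"
      by (simp add: weight_marginal_def sets_P)
    fix B assume "B \<in> sets (weight_marginal (density \<pi> f))"
    hence B [measurable]: "B \<in> sets P" by (simp only: s)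
    have UB [measurable]: "UNIV \<times> B \<in> sets \<pi>"
      using B pair_measureI[of UNIV \<alpha> B P] by (simp add: sets_alpha)
    have "emeasure (weight_marginal (density \<pi> f)) B
        = (\<integral>\<^sup>+ x. f x * indicator (UNIV \<times> B) x \<partial>\<pi>)"
      by (subst emeasure_weight_marginal)
        (auto simp: emeasure_density intro!: nn_integral_cong split: split_indicator)
    also have "\<dots> = (\<integral>\<^sup>+ w. (\<integral>\<^sup>+ \<sigma>. f (\<sigma>, w) * indicator (UNIV \<times> B) (\<sigma>, w) \<partial>\<alpha>) \<partial>P)"
      by (intro nn_integral_snd[symmetric]) measurable
    also have "\<dots> = (\<integral>\<^sup>+ w. indicator B w \<partial>P)"
    proof (rule nn_integral_cong_AE)
      show "AE w in P. (\<integral>\<^sup>+ \<sigma>. f (\<sigma>, w) * indicator (UNIV \<times> B) (\<sigma>, w) \<partial>\<alpha>) = indicator B w"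
        using ae by eventually_elim (auto simp: indicator_def)
    qed
    also have "\<dots> = emeasure P B" by simp
    finally show "emeasure (weight_marginal (density \<pi> f)) B = emeasure P B" .
  qed
qed

text \<open>The total mass is that of the weight marginal, so a measure with marginal
  \<open>P\<close> is a probability measure. Competitors can thus be checked section by
  section.\<close>

lemma admissible_density_iff:
  fixes f :: "'a \<times> real \<Rightarrow> real"
  assumes f [measurable]: "f \<in> borel_measurable \<pi>" and f_nonneg: "\<And>x. 0 \<le> f x"
  shows "density \<pi> f \<in> admissible P \<longleftrightarrow> (AE w in P. (\<integral>\<^sup>+ \<sigma>. f (\<sigma>, w) \<partial>\<alpha>) = 1)"
proof -
  have "prob_space (density \<pi> f)" if m: "weight_marginal (density \<pi> f) = P"
  proof
    have "emeasure (density \<pi> f) (space (density \<pi> f)) = emeasure (weight_marginal (density \<pi> f)) {0<..}"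
      using sets.top[of P] by (subst emeasure_weight_marginal) (auto simp: space_pi space_P)
    also have "\<dots> = 1"
      using weight.emeasure_space_1 by (simp add: m space_P)
    finally show "emeasure (density \<pi> f) (space (density \<pi> f)) = 1" .
  qed
  thus ?thesis
    using weight_marginal_density_iff[OF assms] by (auto simp: admissible_iff)
qed

lemma objective_density:
  fixes f :: "'a \<times> real \<Rightarrow> real"
  assumes "f \<in> borel_measurable \<pi>" "\<And>x. 0 \<le> f x" "density \<pi> f \<in> admissible P"
  shows "objective P \<alpha> U (density \<pi> f)
    = ereal (pair_energy (density \<pi> f) U) - enn2ereal (\<integral>\<^sup>+ x. entropy_excess (f x) 1 \<partial>\<pi>)"
  using assms by (simp add: objective_def nn_integral_relative_entropy admissible_iff)

end

section \<open>Interaction energy\<close>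

locale weighted_model = reference_pair \<alpha> P
  for \<alpha> :: "'a::second_countable_topology measure" and P :: "real measure" +
  fixes \<Phi> :: "'a \<Rightarrow> 'a \<Rightarrow> real" and c m :: real
  assumes Phi_measurable: "(\<lambda>(\<sigma>, \<sigma>'). \<Phi> \<sigma> \<sigma>') \<in> borel_measurable (borel \<Otimes>\<^sub>M borel)"
    and Phi_le: "\<And>\<sigma> \<sigma>'. \<Phi> \<sigma> \<sigma>' \<le> c"
    and Phi_sym: "\<And>\<sigma> \<sigma>'. \<Phi> \<sigma> \<sigma>' = \<Phi> \<sigma>' \<sigma>"
    and integrable_weight: "integrable P (\<lambda>w. w)"
    and mean: "(\<integral>w. w \<partial>P) = m" and mean_pos: "m > 0"
begin

lemma measurable_Phi [measurable (raw)]: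
  assumes "f \<in> M \<rightarrow>\<^sub>M borel" "g \<in> M \<rightarrow>\<^sub>M borel"
  shows "(\<lambda>x. \<Phi> (f x) (g x)) \<in> borel_measurable M"
  using measurable_compose[OF measurable_Pair[OF assms] Phi_measurable] by simp

lemma measurable_site [measurable]: "fst \<in> \<pi> \<rightarrow>\<^sub>M borel"
  using measurable_fst[of \<alpha> P] unfolding measurable_cong_sets[OF refl sets_alpha] .

text \<open>The field \<open>V\<close> of the theorem: the Euler--Lagrange equation at \<open>\<nu>\<close> says that \<open>\<nu>\<^sup>w\<close> has
  density proportional to \<open>exp (w * field \<nu>)\<close>.\<close>

definition field :: "('a \<times> real) measure \<Rightarrow> 'a \<Rightarrow> real" where
  "field \<nu> \<sigma> = (\<integral>x. snd x / m * exp (\<Phi> \<sigma> (fst x)) \<partial>\<nu>)"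

text \<open>The bilinear form behind the interaction: the pair energy is half its diagonal, so along
  a mixture of admissible measures it is a quadratic polynomial in the mixing parameter.\<close>

definition cross_energy :: "('a \<times> real) measure \<Rightarrow> ('a \<times> real) measure \<Rightarrow> real" where
  "cross_energy \<nu> \<mu> = (\<integral>x. snd x * field \<mu> (fst x) \<partial>\<nu>)"

lemma pair_energy_eq: "pair_energy \<nu> (interaction m \<Phi>) = cross_energy \<nu> \<nu> / 2"
proof -
  have "(\<integral>(\<sigma>', w'). interaction m \<Phi> \<sigma> \<sigma>' w w' \<partial>\<nu>) = (w * field \<nu> \<sigma>) * (1 / 2)" for \<sigma> w
  proof -
    have "(\<integral>(\<sigma>', w'). interaction m \<Phi> \<sigma> \<sigma>' w w' \<partial>\<nu>)
        = (\<integral>x. (w / 2) * (snd x / m * exp (\<Phi> \<sigma> (fst x))) \<partial>\<nu>)"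
      by (intro Bochner_Integration.integral_cong) (auto simp: interaction_def)
    also have "\<dots> = (w / 2) * field \<nu> \<sigma>"
      \<comment> \<open>A nonintegrable function has Bochner integral 0, so constants come out
        without an integrability condition.\<close>
      unfolding field_def by (rule integral_mult_right_zero)
    finally show ?thesis by simp
  qed
  thus ?thesis
    unfolding pair_energy_def cross_energy_def case_prod_beta
    by (simp only: integral_mult_left_zero)
qed

context
  fixes \<nu> :: "('a \<times> real) measure"
  assumes adm: "\<nu> \<in> admissible P"
begin

lemma prob_space_admissible: "prob_space \<nu>"
  and sets_admissible [measurable_cong]: "sets \<nu> = sets \<pi>"
  and marginal_admissible: "weight_marginal \<nu> = P"
  using adm by (simp_all add: admissible_iff)

lemma space_admissible: "space \<nu> = UNIV \<times> {0<..}"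
  using sets_eq_imp_space_eq[OF sets_admissible] by (simp add: space_pi)

lemma measurable_coordinates: "fst \<in> \<nu> \<rightarrow>\<^sub>M borel" "snd \<in> borel_measurable \<nu>"
  by measurable

lemma has_integral_weight:
  fixes h :: "real \<Rightarrow> real"
  assumes "integrable P h"
  shows integrable_weight_comp: "integrable \<nu> (\<lambda>x. h (snd x))"
    and integral_weight_comp: "(\<integral>x. h (snd x) \<partial>\<nu>) = (\<integral>w. h w \<partial>P)"
proof -
  have snd: "snd \<in> \<nu> \<rightarrow>\<^sub>M pos_borel"
    unfolding measurable_cong_sets[OF sets_admissible sets_P[symmetric]] by (rule measurable_snd)
  have h: "h \<in> borel_measurable pos_borel"
    using borel_measurable_integrable[OF assms] unfolding measurable_cong_sets[OF sets_P refl] .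
  have P: "P = distr \<nu> pos_borel snd"
    using marginal_admissible by (simp add: weight_marginal_def)
  show "integrable \<nu> (\<lambda>x. h (snd x))"
    using assms unfolding P by (subst (asm) integrable_distr_eq[OF snd h])
  show "(\<integral>x. h (snd x) \<partial>\<nu>) = (\<integral>w. h w \<partial>P)"
    by (subst P) (rule integral_distr[OF snd h, symmetric])
qed

text \<open>Every admissible measure has weight marginal \<open>P\<close>, so a multiple of the
  weight is an integrable bound.\<close>

lemma integrable_weight_times:
  assumes [measurable]: "k \<in> borel_measurable \<pi>" and bound: "\<And>x. \<bar>k x\<bar> \<le> b"
  shows "integrable \<nu> (\<lambda>x. snd x * k x)"
proof (rule Bochner_Integration.integrable_bound)
  show "integrable \<nu> (\<lambda>x. b * snd x)"
    using integrable_weight_comp[OF integrable_weight] by simp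
  show "AE x in \<nu>. norm (snd x * k x) \<le> norm (b * snd x)"
  proof (rule AE_I2)
    fix x assume "x \<in> space \<nu>"
    hence "snd x > 0" by (auto simp: space_admissible)
    moreover have "\<bar>k x\<bar> \<le> \<bar>b\<bar>" using bound[of x] by linarith
    ultimately show "norm (snd x * k x) \<le> norm (b * snd x)"
      by (simp add: abs_mult mult.commute mult_right_mono)
  qed
qed measurable

lemma integrable_field: "integrable \<nu> (\<lambda>x. snd x / m * exp (\<Phi> \<sigma> (fst x)))"
proof -
  have "integrable \<nu> (\<lambda>x. snd x * (exp (\<Phi> \<sigma> (fst x)) / m))"
    by (rule integrable_weight_times[where b = "exp c / m"])
      (use mean_pos Phi_le in \<open>auto simp: divide_right_mono\<close>)
  thus ?thesis by simp
qed

lemma field_nonneg: "0 \<le> field \<nu> \<sigma>"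
  unfolding field_def using mean_pos
  by (intro integral_nonneg_AE AE_I2) (auto simp: space_admissible)

text \<open>The factors \<open>snd x / m\<close> have mean one under an admissible measure, which
  makes the field a weighted average of values of \<open>exp \<Phi>\<close>.\<close>

lemma field_le: "field \<nu> \<sigma> \<le> exp c"
proof -
  have i: "integrable \<nu> (\<lambda>x. snd x / m * exp c)"
    using integrable_weight_comp[OF integrable_weight] by simp
  have "field \<nu> \<sigma> \<le> (\<integral>x. snd x / m * exp c \<partial>\<nu>)"
    unfolding field_def using mean_pos Phi_le
    by (intro integral_mono integrable_field i mult_left_mono) (auto simp: space_admissible)
  also have "\<dots> = (\<integral>x. snd x \<partial>\<nu>) / m * exp c"
    by simp
  also have "\<dots> = exp c"
    using integral_weight_comp[OF integrable_weight] mean mean_pos by simp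
  finally show ?thesis .
qed

lemma measurable_field: "field \<nu> \<in> borel_measurable borel"
proof -
  interpret prob_space \<nu> by (rule prob_space_admissible)
  show ?thesis unfolding field_def by measurable
qed

end

text \<open>Fubini, together with the symmetry of the kernel
  \<open>w * w' / m * exp (\<Phi> \<sigma> \<sigma>')\<close>, which rests on that of
  \<open>\<Phi>\<close>.\<close>

lemma cross_energy_commute:
  assumes \<nu>: "\<nu> \<in> admissible P" and \<mu>: "\<mu> \<in> admissible P"
  shows "cross_energy \<nu> \<mu> = cross_energy \<mu> \<nu>"
proof -
  interpret N: prob_space \<nu> by (rule prob_space_admissible[OF \<nu>])
  interpret M: prob_space \<mu> by (rule prob_space_admissible[OF \<mu>])
  interpret NM: pair_prob_space \<nu> \<mu> ..
  note sets_admissible[OF \<nu>, measurable_cong] sets_admissible[OF \<mu>, measurable_cong]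
  note measurable_field[OF \<mu>, measurable]
  let ?F = "\<lambda>x y. snd x * (snd y / m * exp (\<Phi> (fst x) (fst y)))"
  have "integrable (\<nu> \<Otimes>\<^sub>M \<mu>) (case_prod ?F)"
  proof (rule NM.Fubini_integrable)
    have "integrable \<nu> (\<lambda>x. snd x * field \<mu> (fst x))"
      by (rule integrable_weight_times[OF \<nu>, where b = "exp c"])
        (use field_nonneg[OF \<mu>] field_le[OF \<mu>] in auto)
    \<comment> \<open>Weights are positive, so the norm drops out and the inner integral is
      \<open>snd x\<close> times the field.\<close>
    also have "?this \<longleftrightarrow> integrable \<nu> (\<lambda>x. \<integral>y. norm (case_prod ?F (x, y)) \<partial>\<mu>)"
    proof (intro Bochner_Integration.integrable_cong refl)
      fix x assume "x \<in> space \<nu>"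
      hence x: "snd x > 0" by (auto simp: space_admissible[OF \<nu>])
      have "(\<integral>y. norm (case_prod ?F (x, y)) \<partial>\<mu>) = (\<integral>y. ?F x y \<partial>\<mu>)"
        using x mean_pos
        by (intro Bochner_Integration.integral_cong) (auto simp: space_admissible[OF \<mu>])
      thus "snd x * field \<mu> (fst x) = (\<integral>y. norm (case_prod ?F (x, y)) \<partial>\<mu>)"
        by (simp add: field_def)
    qed
    finally show "integrable \<nu> (\<lambda>x. \<integral>y. norm (case_prod ?F (x, y)) \<partial>\<mu>)" .
    show "AE x in \<nu>. integrable \<mu> (\<lambda>y. case_prod ?F (x, y))"
      unfolding prod.case by (intro AE_I2 integrable_mult_right integrable_field[OF \<mu>])
    show "case_prod ?F \<in> borel_measurable (\<nu> \<Otimes>\<^sub>M \<mu>)"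
      using measurable_coordinates[OF \<nu>] measurable_coordinates[OF \<mu>] by measurable
  qed
  hence "(\<integral>y. (\<integral>x. ?F x y \<partial>\<nu>) \<partial>\<mu>) = (\<integral>x. (\<integral>y. ?F x y \<partial>\<mu>) \<partial>\<nu>)"
    by (rule NM.Fubini_integral)
  moreover have "(\<integral>y. ?F x y \<partial>\<mu>) = snd x * field \<mu> (fst x)" for x
    unfolding field_def by (rule integral_mult_right_zero)
  moreover have "(\<integral>x. ?F x y \<partial>\<nu>) = snd y * field \<nu> (fst y)" for y
  proof -
    have "(\<integral>x. ?F x y \<partial>\<nu>) = (\<integral>x. snd y * (snd x / m * exp (\<Phi> (fst y) (fst x))) \<partial>\<nu>)"
      by (intro Bochner_Integration.integral_cong) (auto simp: Phi_sym[of "fst y"])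
    thus ?thesis
      unfolding field_def by (simp only: integral_mult_right_zero)
  qed
  ultimately show ?thesis
    unfolding cross_energy_def by (simp only:)
qed

lemma integrable_density_iff:
  fixes f h :: "'a \<times> real \<Rightarrow> real"
  assumes "f \<in> borel_measurable \<pi>" "\<And>x. 0 \<le> f x" "h \<in> borel_measurable \<pi>"
  shows "integrable (density \<pi> f) h \<longleftrightarrow> integrable \<pi> (\<lambda>x. f x * h x)"
  using assms by (intro integrable_real_density) auto

section \<open>Mixtures of two admissible densities\<close>

context
  fixes f g :: "'a \<times> real \<Rightarrow> real" and t :: real
  assumes f [measurable]: "f \<in> borel_measurable \<pi>" and f_nonneg: "\<And>x. 0 \<le> f x"
    and f_adm: "density \<pi> f \<in> admissible P"
    and g [measurable]: "g \<in> borel_measurable \<pi>" and g_nonneg: "\<And>x. 0 \<le> g x"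
    and g_adm: "density \<pi> g \<in> admissible P"
    and t: "0 < t" "t < 1"
begin

abbreviation "mix \<equiv> \<lambda>x. (1 - t) * f x + t * g x"

lemma mix_nonneg: "0 \<le> mix x"
  using f_nonneg g_nonneg t by simp

lemma mix_admissible: "density \<pi> mix \<in> admissible P"
proof -
  have "AE w in P. (\<integral>\<^sup>+ \<sigma>. f (\<sigma>, w) \<partial>\<alpha>) = 1" "AE w in P. (\<integral>\<^sup>+ \<sigma>. g (\<sigma>, w) \<partial>\<alpha>) = 1"
    using f_adm g_adm f_nonneg g_nonneg by (simp_all add: admissible_density_iff)
  hence "AE w in P. (\<integral>\<^sup>+ \<sigma>. mix (\<sigma>, w) \<partial>\<alpha>) = 1"
    using AE_space
  proof eventually_elim
    case (elim w)
    note [measurable] = elim(3)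
    have "(\<integral>\<^sup>+ \<sigma>. mix (\<sigma>, w) \<partial>\<alpha>)
        = (\<integral>\<^sup>+ \<sigma>. ennreal (1 - t) * f (\<sigma>, w) + ennreal t * g (\<sigma>, w) \<partial>\<alpha>)"
      using t f_nonneg g_nonneg
      by (intro nn_integral_cong) (simp add: ennreal_plus ennreal_mult del: ennreal_minus)
    also have "\<dots> = ennreal (1 - t) * (\<integral>\<^sup>+ \<sigma>. f (\<sigma>, w) \<partial>\<alpha>) + ennreal t * (\<integral>\<^sup>+ \<sigma>. g (\<sigma>, w) \<partial>\<alpha>)"
      by (subst nn_integral_add) (auto simp: nn_integral_cmult)
    also have "\<dots> = ennreal (1 - t + t)"
      using t elim by (subst ennreal_plus) auto
    finally show ?case by simp
  qed
  thus ?thesis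
    using mix_nonneg by (subst admissible_density_iff) auto
qed

lemma integral_mix:
  assumes [measurable]: "h \<in> borel_measurable \<pi>"
    and "integrable (density \<pi> f) h" "integrable (density \<pi> g) h"
  shows "(\<integral>x. h x \<partial>density \<pi> mix) = (1 - t) * (\<integral>x. h x \<partial>density \<pi> f) + t * (\<integral>x. h x \<partial>density \<pi> g)"
proof -
  have i: "integrable \<pi> (\<lambda>x. f x * h x)" "integrable \<pi> (\<lambda>x. g x * h x)"
    using assms f_nonneg g_nonneg by (simp_all add: integrable_density_iff)
  have "(\<integral>x. h x \<partial>density \<pi> mix) = (\<integral>x. mix x * h x \<partial>\<pi>)"
    using mix_nonneg by (subst integral_real_density) auto
  also have "\<dots> = (\<integral>x. (1 - t) * (f x * h x) + t * (g x * h x) \<partial>\<pi>)"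
    by (simp add: algebra_simps)
  also have "\<dots> = (1 - t) * (\<integral>x. f x * h x \<partial>\<pi>) + t * (\<integral>x. g x * h x \<partial>\<pi>)"
    using i by simp
  finally show ?thesis
    using f_nonneg g_nonneg by (simp add: integral_real_density)
qed

lemma field_mix: "field (density \<pi> mix) \<sigma> = (1 - t) * field (density \<pi> f) \<sigma> + t * field (density \<pi> g) \<sigma>"
  unfolding field_def
  by (intro integral_mix integrable_field f_adm g_adm) measurable

text \<open>Linearity in the second argument comes from that of \<open>field\<close>, in the first
  by symmetry. Symmetry also merges the two mixed terms, whence the factor 2.\<close>

lemma cross_energy_mix:
  "cross_energy (density \<pi> mix) (density \<pi> mix)
    = (1 - t)\<^sup>2 * cross_energy (density \<pi> f) (density \<pi> f)
      + 2 * t * (1 - t) * cross_energy (density \<pi> g) (density \<pi> f)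
      + t\<^sup>2 * cross_energy (density \<pi> g) (density \<pi> g)"
proof -
  let ?f = "density \<pi> f" and ?g = "density \<pi> g" and ?m = "density \<pi> mix"
  note [measurable] = measurable_field[OF f_adm] measurable_field[OF g_adm]
  have i: "integrable \<nu> (\<lambda>x. snd x * field \<mu> (fst x))"
    if "\<nu> \<in> admissible P" "\<mu> \<in> admissible P" for \<nu> \<mu>
  proof -
    note [measurable] = measurable_field[OF that(2)]
    show ?thesis
      by (rule integrable_weight_times[OF that(1), where b = "exp c"])
        (use field_nonneg[OF that(2)] field_le[OF that(2)] in auto)
  qed
  have "cross_energy \<nu> ?m = (1 - t) * cross_energy \<nu> ?f + t * cross_energy \<nu> ?g"
    if "\<nu> \<in> admissible P" for \<nu>
  proof -
    have "cross_energy \<nu> ?m = (\<integral>x. (1 - t) * (snd x * field ?f (fst x)) + t * (snd x * field ?g (fst x)) \<partial>\<nu>)"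
      unfolding cross_energy_def field_mix
      by (intro Bochner_Integration.integral_cong) (auto simp: algebra_simps)
    thus ?thesis
      using i[OF that f_adm] i[OF that g_adm] by (simp add: cross_energy_def)
  qed
  note right = this
  have left: "cross_energy ?m \<mu> = (1 - t) * cross_energy ?f \<mu> + t * cross_energy ?g \<mu>"
    if "\<mu> \<in> admissible P" for \<mu>
    using right[OF that] cross_energy_commute[OF that] f_adm g_adm mix_admissible by simp
  show ?thesis
    unfolding left[OF mix_admissible] right[OF f_adm] right[OF g_adm]
      cross_energy_commute[OF f_adm g_adm]
    by (simp add: power2_eq_square algebra_simps)
qed

lemma entropy_mix:
  "(\<integral>\<^sup>+ x. entropy_excess (mix x) 1 \<partial>\<pi>)
    \<le> ennreal (1 - t) * (\<integral>\<^sup>+ x. entropy_excess (f x) 1 \<partial>\<pi>)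
      + ennreal t * (\<integral>\<^sup>+ x. entropy_excess (g x) 1 \<partial>\<pi>)"
proof -
  have "(\<integral>\<^sup>+ x. entropy_excess (mix x) 1 \<partial>\<pi>)
      \<le> (\<integral>\<^sup>+ x. ennreal (1 - t) * entropy_excess (f x) 1 + ennreal t * entropy_excess (g x) 1 \<partial>\<pi>)"
  proof (rule nn_integral_mono)
    fix x
    have "ennreal (entropy_excess (mix x) 1)
        \<le> ennreal ((1 - t) * entropy_excess (f x) 1 + t * entropy_excess (g x) 1)"
      using f_nonneg g_nonneg t by (intro ennreal_leI entropy_excess_convex) auto
    also have "\<dots> = ennreal (1 - t) * entropy_excess (f x) 1 + ennreal t * entropy_excess (g x) 1"
      using f_nonneg g_nonneg t
      by (subst ennreal_plus) (auto simp: ennreal_mult' entropy_excess_nonneg)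
    finally show "ennreal (entropy_excess (mix x) 1)
        \<le> ennreal (1 - t) * entropy_excess (f x) 1 + ennreal t * entropy_excess (g x) 1" .
  qed
  also have "\<dots> = ennreal (1 - t) * (\<integral>\<^sup>+ x. entropy_excess (f x) 1 \<partial>\<pi>)
      + ennreal t * (\<integral>\<^sup>+ x. entropy_excess (g x) 1 \<partial>\<pi>)"
    by (subst nn_integral_add) (auto simp: nn_integral_cmult)
  finally show ?thesis .
qed

end

end

section \<open>Gibbs measures and maximizers\<close>

definition (in reference_pair) partition :: "('a \<Rightarrow> real) \<Rightarrow> real \<Rightarrow> real" where
  "partition V w = (\<integral>\<tau>. exp (w * V \<tau>) \<partial>\<alpha>)"

text \<open>A joint density with respect to \<open>\<pi>\<close>, normalized separately at each
  weight: for the fields considered below this keeps the weight marginal equal to \<open>P\<close>,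
  which a single global constant would not do in general.\<close>

definition (in reference_pair) gibbs :: "('a \<Rightarrow> real) \<Rightarrow> 'a \<times> real \<Rightarrow> real" where
  "gibbs V x = exp (snd x * V (fst x)) / partition V (snd x)"

context weighted_model
begin

section \<open>Gibbs densities of a bounded nonnegative field\<close>

context
  fixes V :: "'a \<Rightarrow> real" and b :: real
  assumes V [measurable]: "V \<in> borel_measurable borel"
    and V_nonneg: "\<And>\<sigma>. 0 \<le> V \<sigma>" and V_le: "\<And>\<sigma>. V \<sigma> \<le> b"
begin

lemma integrable_exp: "w > 0 \<Longrightarrow> integrable \<alpha> (\<lambda>\<sigma>. exp (w * V \<sigma>))"
  using V_le by (intro alpha.integrable_const_bound[where B = "exp (w * b)"]) auto

text \<open>Nonnegativity of \<open>V\<close> makes the integrand at least one. Hence the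
  normalization never vanishes, and its logarithm is nonnegative.\<close>

lemma partition_ge_1: "w > 0 \<Longrightarrow> 1 \<le> partition V w"
  using integral_mono[of \<alpha> "\<lambda>_. 1" "\<lambda>\<sigma>. exp (w * V \<sigma>)"] integrable_exp V_nonneg
  by (simp add: partition_def alpha.prob_space)

lemma partition_le: "w > 0 \<Longrightarrow> partition V w \<le> exp (w * b)"
  using integral_mono[of \<alpha> "\<lambda>\<sigma>. exp (w * V \<sigma>)" "\<lambda>_. exp (w * b)"] integrable_exp V_le
  by (simp add: partition_def alpha.prob_space)

lemma measurable_partition [measurable]: "partition V \<in> borel_measurable P"
  unfolding partition_def by measurable

text \<open>The logarithm lies between 0 and \<open>b * w\<close>, by the two bounds on the
  partition function, and the weight has finite mean.\<close>

lemma integrable_ln_partition: "integrable P (\<lambda>w. ln (partition V w))"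
proof (rule Bochner_Integration.integrable_bound)
  show "integrable P (\<lambda>w. b * w)" using integrable_weight by simp
  show "AE w in P. norm (ln (partition V w)) \<le> norm (b * w)"
  proof (rule AE_I2)
    fix w assume "w \<in> space P"
    hence w: "w > 0" by (simp add: space_P)
    have "ln (partition V w) \<le> ln (exp (w * b))"
      using partition_ge_1[OF w] partition_le[OF w] by (subst ln_le_cancel_iff) auto
    moreover have "0 \<le> ln (partition V w)"
      using partition_ge_1[OF w] by simp
    moreover have "0 \<le> b" using V_nonneg V_le order_trans by blast
    ultimately show "norm (ln (partition V w)) \<le> norm (b * w)"
      using w by (simp add: mult.commute)
  qed
qed measurable

lemma measurable_gibbs [measurable]: "gibbs V \<in> borel_measurable \<pi>"
  unfolding gibbs_def by measurable

lemma gibbs_nonneg: "0 \<le> gibbs V x"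
  by (simp add: gibbs_def partition_def)

lemma gibbs_pos: "x \<in> space \<pi> \<Longrightarrow> 0 < gibbs V x"
  using partition_ge_1[of "snd x"] by (force simp: gibbs_def space_pi)

lemma ln_gibbs: "x \<in> space \<pi> \<Longrightarrow> ln (gibbs V x) = snd x * V (fst x) - ln (partition V (snd x))"
  using partition_ge_1[of "snd x"] by (force simp: gibbs_def space_pi ln_div)

lemma gibbs_admissible: "density \<pi> (gibbs V) \<in> admissible P"
proof -
  have "(\<integral>\<^sup>+ \<sigma>. gibbs V (\<sigma>, w) \<partial>\<alpha>) = 1" if "w > 0" for w
  proof -
    have i: "integrable \<alpha> (\<lambda>\<sigma>. gibbs V (\<sigma>, w))"
      using integrable_exp[OF that] by (simp add: gibbs_def)
    have "(\<integral>\<^sup>+ \<sigma>. gibbs V (\<sigma>, w) \<partial>\<alpha>) = ennreal (\<integral>\<sigma>. gibbs V (\<sigma>, w) \<partial>\<alpha>)"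
      using i gibbs_nonneg by (intro nn_integral_eq_integral) auto
    also have "(\<integral>\<sigma>. gibbs V (\<sigma>, w) \<partial>\<alpha>) = partition V w / partition V w"
      by (simp add: gibbs_def partition_def)
    finally show ?thesis
      using partition_ge_1[OF that] by simp
  qed
  thus ?thesis
    by (subst admissible_density_iff) (auto simp: gibbs_nonneg space_P)
qed

lemma integrable_admissible_density:
  fixes f :: "'a \<times> real \<Rightarrow> real"
  assumes [measurable]: "f \<in> borel_measurable \<pi>" and "\<And>x. 0 \<le> f x" "density \<pi> f \<in> admissible P"
  shows "integrable \<pi> f" "(\<integral>x. f x \<partial>\<pi>) = 1"
proof -
  interpret prob_space "density \<pi> f" by (rule prob_space_admissible) fact
  have "integrable (density \<pi> f) (\<lambda>x. 1 :: real)" by simp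
  thus "integrable \<pi> f"
    using assms by (subst (asm) integrable_density_iff) auto
  have "(\<integral>x. 1 \<partial>density \<pi> f) = (\<integral>x. f x * 1 \<partial>\<pi>)"
    using assms by (intro integral_real_density) auto
  thus "(\<integral>x. f x \<partial>\<pi>) = 1" using prob_space by simp
qed

text \<open>The Gibbs variational principle: the last integral is the entropy of \<open>density \<pi> f\<close> relative
  to the Gibbs measure.\<close>

lemma gibbs_variational:
  fixes f :: "'a \<times> real \<Rightarrow> real"
  assumes f [measurable]: "f \<in> borel_measurable \<pi>" and f_nonneg: "\<And>x. 0 \<le> f x"
    and f_adm: "density \<pi> f \<in> admissible P"
  shows integrable_gibbs_variational: "integrable \<pi> (\<lambda>x. entropy_excess (f x) 1)
      \<longleftrightarrow> integrable \<pi> (\<lambda>x. entropy_excess (f x) (gibbs V x))"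
    and integral_gibbs_variational: "integrable \<pi> (\<lambda>x. entropy_excess (f x) 1) \<Longrightarrow>
      (\<integral>x. entropy_excess (f x) 1 \<partial>\<pi>) - (\<integral>x. snd x * V (fst x) \<partial>density \<pi> f)
        + (\<integral>w. ln (partition V w) \<partial>P) = (\<integral>x. entropy_excess (f x) (gibbs V x) \<partial>\<pi>)"
proof -
  have i1: "integrable \<pi> (\<lambda>x. f x * (snd x * V (fst x)))"
  proof -
    have "integrable (density \<pi> f) (\<lambda>x. snd x * V (fst x))"
      by (rule integrable_weight_times[OF f_adm, where b = b]) (use V_nonneg V_le in auto)
    thus ?thesis using f_nonneg by (subst (asm) integrable_density_iff) auto
  qed
  have i2: "integrable \<pi> (\<lambda>x. f x * ln (partition V (snd x)))"
    using integrable_weight_comp[OF f_adm integrable_ln_partition] f_nonneg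
    by (subst (asm) integrable_density_iff) auto
  have e1: "(\<integral>x. f x * (snd x * V (fst x)) \<partial>\<pi>) = (\<integral>x. snd x * V (fst x) \<partial>density \<pi> f)"
    using f_nonneg by (subst integral_real_density) auto
  have e2: "(\<integral>x. f x * ln (partition V (snd x)) \<partial>\<pi>) = (\<integral>w. ln (partition V w) \<partial>P)"
    using f_nonneg integral_weight_comp[OF f_adm integrable_ln_partition]
    by (subst (asm) integral_real_density) auto
  note g = integrable_admissible_density[OF measurable_gibbs gibbs_nonneg gibbs_admissible]
  \<comment> \<open>The difference of the two excesses, read off from \<open>ln_gibbs\<close>. It is
    integrable even if the excesses are not, and its last two terms cancel on integration.\<close>
  let ?r = "\<lambda>x. f x * ln (partition V (snd x)) - f x * (snd x * V (fst x)) + gibbs V x - 1"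
  have r: "integrable \<pi> ?r"
    by (intro Bochner_Integration.integrable_add Bochner_Integration.integrable_diff i1 i2 g
        integrable_const)
  have eq: "entropy_excess (f x) (gibbs V x) = entropy_excess (f x) 1 + ?r x" if "x \<in> space \<pi>" for x
    unfolding entropy_excess_def ln_gibbs[OF that] by (simp add: algebra_simps)
  have "integrable \<pi> (\<lambda>x. entropy_excess (f x) (gibbs V x))
      \<longleftrightarrow> integrable \<pi> (\<lambda>x. entropy_excess (f x) 1 + ?r x)"
    by (intro Bochner_Integration.integrable_cong refl eq)
  also have "\<dots> \<longleftrightarrow> integrable \<pi> (\<lambda>x. entropy_excess (f x) 1)"
    using Bochner_Integration.integrable_add[OF _ r, of "\<lambda>x. entropy_excess (f x) 1"]
      Bochner_Integration.integrable_diff[OF _ r, of "\<lambda>x. entropy_excess (f x) 1 + ?r x"]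
    by (auto simp only: add_diff_cancel_right')
  finally show "integrable \<pi> (\<lambda>x. entropy_excess (f x) 1)
      \<longleftrightarrow> integrable \<pi> (\<lambda>x. entropy_excess (f x) (gibbs V x))" ..
  assume i: "integrable \<pi> (\<lambda>x. entropy_excess (f x) 1)"
  have "(\<integral>x. entropy_excess (f x) (gibbs V x) \<partial>\<pi>) = (\<integral>x. entropy_excess (f x) 1 + ?r x \<partial>\<pi>)"
    by (intro Bochner_Integration.integral_cong refl eq)
  also have "\<dots> = (\<integral>x. entropy_excess (f x) 1 \<partial>\<pi>) + (\<integral>x. ?r x \<partial>\<pi>)"
    by (rule Bochner_Integration.integral_add[OF i r])
  also have "(\<integral>x. ?r x \<partial>\<pi>)
      = (\<integral>w. ln (partition V w) \<partial>P) - (\<integral>x. snd x * V (fst x) \<partial>density \<pi> f)"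
    using i1 i2 g e1 e2 by (simp add: prob_space)
  finally show "(\<integral>x. entropy_excess (f x) 1 \<partial>\<pi>) - (\<integral>x. snd x * V (fst x) \<partial>density \<pi> f)
        + (\<integral>w. ln (partition V w) \<partial>P) = (\<integral>x. entropy_excess (f x) (gibbs V x) \<partial>\<pi>)"
    by simp
qed

end

section \<open>Maximizers and their first-order condition\<close>

lemma maximizer_finite_entropy:
  assumes max: "is_maximizer P \<alpha> U \<nu>"
  shows "(\<integral>\<^sup>+ w. relative_entropy (cond_distribution \<nu> w) \<alpha> \<partial>P) < \<infinity>"
proof (rule ccontr)
  assume "\<not> ?thesis"
  hence "(\<integral>\<^sup>+ w. relative_entropy (cond_distribution \<nu> w) \<alpha> \<partial>P) = top"
    by (simp only: infinity_ennreal_def less_top[symmetric] not_not)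
  hence "objective P \<alpha> U \<nu> = - \<infinity>"
    by (simp add: objective_def)
  \<comment> \<open>The constant density 1 gives the product measure, with entropy 0 and a finite
    objective; a maximizer cannot have the value minus infinity.\<close>
  moreover have adm: "density \<pi> (\<lambda>_. ennreal 1) \<in> admissible P"
    by (subst admissible_density_iff) (auto simp: alpha.emeasure_space_1)
  have "objective P \<alpha> U (density \<pi> (\<lambda>_. ennreal 1)) = ereal (pair_energy (density \<pi> (\<lambda>_. ennreal 1)) U)"
    by (subst objective_density[OF _ _ adm]) (auto simp: entropy_excess_def zero_ennreal.rep_eq)
  ultimately show False
    using max adm unfolding is_maximizer_def by fastforce
qed

text \<open>Stands in for differentiation at \<open>t = 0\<close> along the mixture:
  \<open>a\<close> will be the first-order change and \<open>d\<close> the coefficient of the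
  second-order remainder.\<close>

lemma nonpos_if_perturbation_nonpos:
  fixes a d :: real
  assumes "\<And>t. 0 < t \<Longrightarrow> t < 1 \<Longrightarrow> a + t * d \<le> 0"
  shows "a \<le> 0"
proof (rule ccontr)
  assume "\<not> a \<le> 0"
  hence a: "a > 0" by simp
  \<comment> \<open>This \<open>t\<close> is at most 1/2 and makes \<open>t * \<bar>d\<bar>\<close>
    at most \<open>a / 2\<close>, so the perturbation cannot outweigh \<open>a\<close>.\<close>
  define t where "t = a / (2 * (a + \<bar>d\<bar>))"
  have t: "0 < t" "t < 1" using a by (auto simp: t_def field_simps)
  have "t * \<bar>d\<bar> \<le> a / 2" using a by (auto simp: t_def field_simps)
  moreover have "- (t * \<bar>d\<bar>) \<le> t * d"
    using t by (simp add: abs_if)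
  ultimately show False using assms[OF t] a by linarith
qed

lemma maximizer_gibbs:
  assumes max: "is_maximizer P \<alpha> (interaction m \<Phi>) \<nu>" and cond: "is_cond_distribution \<nu> \<kappa>"
  shows "\<nu> = density \<pi> (gibbs (field \<nu>))"
proof -
  have \<nu>: "\<nu> \<in> admissible P" using max by (simp add: is_maximizer_def)
  have fin: "(\<integral>\<^sup>+ w. relative_entropy (cond_distribution \<nu> w) \<alpha> \<partial>P) < \<infinity>"
    using max by (rule maximizer_finite_entropy)
  \<comment> \<open>The given \<open>\<kappa>\<close> shows that a version exists, so the chosen
    \<open>cond_distribution \<nu>\<close> is one.\<close>
  have cond': "is_cond_distribution \<nu> (cond_distribution \<nu>)"
    unfolding cond_distribution_def by (rule someI[of "is_cond_distribution \<nu>"]) fact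
  obtain f :: "'a \<times> real \<Rightarrow> real"
    where f [measurable]: "f \<in> borel_measurable \<pi>" and f_nonneg: "\<And>x. 0 \<le> f x"
    and \<nu>f: "\<nu> = density \<pi> f"
    by (rule density_if_finite_entropy[OF prob_space_admissible[OF \<nu>] sets_admissible[OF \<nu>]
          marginal_admissible[OF \<nu>] cond' fin]) (rule that)
  have f_adm: "density \<pi> f \<in> admissible P" using \<nu> \<nu>f by simp
  define V where "V = field \<nu>"
  have V [measurable]: "V \<in> borel_measurable borel" and V_nonneg: "\<And>\<sigma>. 0 \<le> V \<sigma>"
    and V_le: "\<And>\<sigma>. V \<sigma> \<le> exp c"
    unfolding V_def using measurable_field[OF \<nu>] field_nonneg[OF \<nu>] field_le[OF \<nu>] by auto
  define g where "g = gibbs V"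
  have g [measurable]: "g \<in> borel_measurable \<pi>" and g_nonneg: "\<And>x. 0 \<le> g x"
    and g_adm: "density \<pi> g \<in> admissible P" and g_pos: "\<And>x. x \<in> space \<pi> \<Longrightarrow> 0 < g x"
    unfolding g_def using measurable_gibbs[OF V V_nonneg V_le] gibbs_nonneg[OF V V_nonneg V_le]
      gibbs_admissible[OF V V_nonneg V_le] gibbs_pos[OF V V_nonneg V_le] by auto
  note variational = gibbs_variational[OF V V_nonneg V_le, folded g_def]
  let ?If = "\<integral>x. entropy_excess (f x) 1 \<partial>\<pi>" and ?Ig = "\<integral>x. entropy_excess (g x) 1 \<partial>\<pi>"
  let ?B = "\<lambda>\<nu> \<mu>. cross_energy (density \<pi> \<nu>) (density \<pi> \<mu>)"

  have excess_nonneg: "0 \<le> entropy_excess (f x) 1" "0 \<le> entropy_excess (g x) 1" for x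
    by (simp_all add: entropy_excess_nonneg f_nonneg g_nonneg)
  have "(\<integral>\<^sup>+ x. entropy_excess (f x) 1 \<partial>\<pi>) < \<infinity>"
    using fin nn_integral_relative_entropy[OF f f_nonneg marginal_admissible[OF f_adm]] \<nu>f by simp
  hence int_f: "integrable \<pi> (\<lambda>x. entropy_excess (f x) 1)"
    using excess_nonneg by (intro integrableI_nonneg) auto
  \<comment> \<open>Relative to itself the Gibbs density has zero excess. The variational principle
    applied to \<open>g\<close> therefore gives finite entropy and, further down, the exact value of
    the linearized functional.\<close>
  have excess_gg: "entropy_excess (g x) (g x) = 0" for x
    by (simp add: entropy_excess_def)
  have int_g: "integrable \<pi> (\<lambda>x. entropy_excess (g x) 1)"
    using variational(1)[OF g g_nonneg g_adm] by (simp add: excess_gg)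
  have nn_f: "(\<integral>\<^sup>+ x. entropy_excess (f x) 1 \<partial>\<pi>) = ennreal ?If"
    using int_f excess_nonneg by (intro nn_integral_eq_integral) auto
  have nn_g: "(\<integral>\<^sup>+ x. entropy_excess (g x) 1 \<partial>\<pi>) = ennreal ?Ig"
    using int_g excess_nonneg by (intro nn_integral_eq_integral) auto
  have If_nonneg: "0 \<le> ?If" and Ig_nonneg: "0 \<le> ?Ig"
    using excess_nonneg by simp_all

  \<comment> \<open>The first-order condition: entropy minus energy in the field of
    \<open>\<nu>\<close> is no larger at \<open>f\<close> than at \<open>g\<close>. The energies
    carry no factor 1/2 because the quadratic form has been differentiated.\<close>
  have "?If - ?B f f - (?Ig - ?B g f) \<le> 0"
  proof (rule nonpos_if_perturbation_nonpos)
    fix t :: real assume t: "0 < t" "t < 1"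
    let ?h = "\<lambda>x. (1 - t) * f x + t * g x"
    note mix = f f_nonneg f_adm g g_nonneg g_adm t
    have h_adm: "density \<pi> ?h \<in> admissible P" by (rule mix_admissible[OF mix])
    have h_nonneg: "0 \<le> ?h x" for x by (rule mix_nonneg[OF mix])
    let ?Y = "(1 - t) * ?If + t * ?Ig"
    have "(\<integral>\<^sup>+ x. entropy_excess (?h x) 1 \<partial>\<pi>) \<le> ennreal (1 - t) * ennreal ?If + ennreal t * ennreal ?Ig"
      using entropy_mix[OF mix] by (simp only: nn_f nn_g)
    also have "\<dots> = ennreal ?Y"
      using t If_nonneg Ig_nonneg by (simp add: ennreal_plus ennreal_mult del: ennreal_minus)
    finally have "enn2ereal (\<integral>\<^sup>+ x. entropy_excess (?h x) 1 \<partial>\<pi>) \<le> enn2ereal (ennreal ?Y)"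
      by (simp only: less_eq_ennreal.rep_eq)
    also have "\<dots> = ereal ?Y"
      using t If_nonneg Ig_nonneg by (intro enn2ereal_ennreal) auto
    \<comment> \<open>Convexity bounds the entropy of the mixture from above, hence its objective
      from below.\<close>
    finally have "ereal (?B ?h ?h / 2) - ereal ?Y
        \<le> ereal (?B ?h ?h / 2) - enn2ereal (\<integral>\<^sup>+ x. entropy_excess (?h x) 1 \<partial>\<pi>)"
      by (intro ereal_minus_mono) auto
    also have "\<dots> = objective P \<alpha> (interaction m \<Phi>) (density \<pi> ?h)"
      by (subst objective_density[OF _ h_nonneg h_adm]) (auto simp: pair_energy_eq)
    also have "\<dots> \<le> objective P \<alpha> (interaction m \<Phi>) (density \<pi> f)"
      using max h_adm \<nu>f by (simp add: is_maximizer_def)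
    also have "\<dots> = ereal (?B f f / 2) - enn2ereal (ennreal ?If)"
      by (subst objective_density[OF f f_nonneg f_adm]) (simp add: pair_energy_eq nn_f)
    also have "\<dots> = ereal (?B f f / 2) - ereal ?If"
      using If_nonneg by (simp only: enn2ereal_ennreal)
    finally have le: "?B ?h ?h / 2 - ?Y \<le> ?B f f / 2 - ?If" by simp
    \<comment> \<open>\<open>A\<close>, \<open>B\<close>, \<open>D\<close> stand for the energies
      \<open>?B f f\<close>, \<open>?B g f\<close>, \<open>?B g g\<close>, and \<open>I\<close>,
      \<open>J\<close> for the entropies of \<open>f\<close> and \<open>g\<close>. The right side
      bounds the gain of the mixture over \<open>f\<close> from below; dividing by \<open>t\<close>
      leaves the first-order term plus \<open>t\<close> times a constant.\<close>
    have "t * ((I - A - (J - B)) + t * (A / 2 - B + D / 2))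
        = (((1 - t)\<^sup>2 * A + 2 * t * (1 - t) * B + t\<^sup>2 * D) / 2 - ((1 - t) * I + t * J)) - (A / 2 - I)"
      for A B D I J :: real
      by (simp add: power2_eq_square field_simps)
    from this[of ?If "?B f f" ?Ig "?B g f" "?B g g"]
    have "t * ((?If - ?B f f - (?Ig - ?B g f)) + t * (?B f f / 2 - ?B g f + ?B g g / 2)) \<le> 0"
      using le unfolding cross_energy_mix[OF mix] by simp
    thus "(?If - ?B f f - (?Ig - ?B g f)) + t * (?B f f / 2 - ?B g f + ?B g g / 2) \<le> 0"
      using t by (simp add: mult_le_0_iff)
  qed
  \<comment> \<open>At \<open>g\<close> the variational principle holds with equality, and at
    \<open>f\<close> the defect is the excess relative to \<open>g\<close>. By subtraction the
    first-order condition makes this excess integrate to at most 0.\<close>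
  moreover have "?Ig - ?B g f + (\<integral>w. ln (partition V w) \<partial>P) = 0"
    using variational(2)[OF g g_nonneg g_adm int_g]
    by (simp add: cross_energy_def V_def \<nu>f excess_gg)
  moreover have "?If - ?B f f + (\<integral>w. ln (partition V w) \<partial>P) = (\<integral>x. entropy_excess (f x) (g x) \<partial>\<pi>)"
    using variational(2)[OF f f_nonneg f_adm int_f]
    by (simp add: cross_energy_def V_def \<nu>f)
  ultimately have le: "(\<integral>x. entropy_excess (f x) (g x) \<partial>\<pi>) \<le> 0" by linarith
  have nn: "AE x in \<pi>. 0 \<le> entropy_excess (f x) (g x)"
    by (intro AE_I2 entropy_excess_nonneg f_nonneg g_pos)
  have int: "integrable \<pi> (\<lambda>x. entropy_excess (f x) (g x))"
    using variational(1)[OF f f_nonneg f_adm] int_f by simp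
  have "(\<integral>x. entropy_excess (f x) (g x) \<partial>\<pi>) = 0"
    using le integral_nonneg_AE[OF nn] by linarith
  hence "AE x in \<pi>. entropy_excess (f x) (g x) = 0"
    using integral_nonneg_eq_0_iff_AE[OF int nn] by simp
  hence "AE x in \<pi>. ennreal (f x) = ennreal (g x)"
    using AE_space
  proof eventually_elim
    case (elim x)
    show ?case using entropy_excess_eq_0[OF f_nonneg g_pos elim(1)] elim(2) by simp
  qed
  hence "density \<pi> f = density \<pi> g"
    by (intro density_cong) auto
  thus ?thesis
    unfolding \<nu>f[symmetric] g_def V_def .
qed

text \<open>Inserting the Gibbs density and integrating out the site at fixed weight leaves the
  factor \<open>w / m\<close>, the density of the size-biased law. With \<open>V\<close> taken as
  \<open>field \<nu>\<close> this becomes the fixed point equation.\<close>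

lemma field_fixed_point:
  assumes \<nu>: "\<nu> \<in> admissible P" and eq: "\<nu> = density \<pi> (gibbs V)"
    and V [measurable]: "V \<in> borel_measurable borel" and V_nonneg: "\<And>\<sigma>. 0 \<le> V \<sigma>"
    and V_le: "\<And>\<sigma>. V \<sigma> \<le> b"
  shows "field \<nu> \<sigma> = (\<integral>w. (\<integral>\<tau>. exp (\<Phi> \<sigma> \<tau>) * exp (w * V \<tau>) \<partial>\<alpha>) / partition V w \<partial>size_biased m P)"
proof -
  note [measurable] = measurable_gibbs[OF V V_nonneg V_le] measurable_partition[OF V V_nonneg V_le]
  let ?F = "\<lambda>\<tau> w. gibbs V (\<tau>, w) * (w / m * exp (\<Phi> \<sigma> \<tau>))"
  have "integrable \<pi> (\<lambda>x. gibbs V x * (snd x / m * exp (\<Phi> \<sigma> (fst x))))"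
    using integrable_field[OF \<nu>, of \<sigma>] gibbs_nonneg[OF V V_nonneg V_le] unfolding eq
    by (subst (asm) integrable_density_iff) auto
  hence i: "integrable \<pi> (case_prod ?F)"
    unfolding case_prod_unfold prod.collapse .
  have "field \<nu> \<sigma> = (\<integral>x. gibbs V x * (snd x / m * exp (\<Phi> \<sigma> (fst x))) \<partial>\<pi>)"
    unfolding field_def eq using gibbs_nonneg[OF V V_nonneg V_le]
    by (intro integral_real_density) auto
  also have "\<dots> = (\<integral>x. case_prod ?F x \<partial>\<pi>)"
    by (simp add: case_prod_beta)
  also have "\<dots> = (\<integral>w. (\<integral>\<tau>. ?F \<tau> w \<partial>\<alpha>) \<partial>P)"
    by (rule integral_snd[OF i, symmetric])
  also have "\<dots> = (\<integral>w. w / m * ((\<integral>\<tau>. exp (\<Phi> \<sigma> \<tau>) * exp (w * V \<tau>) \<partial>\<alpha>) / partition V w) \<partial>P)"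
  proof (intro Bochner_Integration.integral_cong refl)
    fix w
    have "(\<integral>\<tau>. ?F \<tau> w \<partial>\<alpha>)
        = (\<integral>\<tau>. (w / m / partition V w) * (exp (\<Phi> \<sigma> \<tau>) * exp (w * V \<tau>)) \<partial>\<alpha>)"
      by (intro Bochner_Integration.integral_cong) (auto simp: gibbs_def ac_simps)
    also have "\<dots> = (w / m / partition V w) * (\<integral>\<tau>. exp (\<Phi> \<sigma> \<tau>) * exp (w * V \<tau>) \<partial>\<alpha>)"
      by (rule integral_mult_right_zero)
    finally show "(\<integral>\<tau>. ?F \<tau> w \<partial>\<alpha>)
        = w / m * ((\<integral>\<tau>. exp (\<Phi> \<sigma> \<tau>) * exp (w * V \<tau>) \<partial>\<alpha>) / partition V w)"
      by simp
  qed
  also have "\<dots> = (\<integral>w. (\<integral>\<tau>. exp (\<Phi> \<sigma> \<tau>) * exp (w * V \<tau>) \<partial>\<alpha>) / partition V w \<partial>size_biased m P)"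
    unfolding size_biased_def
  proof (rule integral_real_density[symmetric])
    show "AE w in P. 0 \<le> w / m" using mean_pos by (auto simp: space_P)
  qed measurable
  finally show ?thesis .
qed

text \<open>Passes from the joint density to an arbitrary version: at almost every \<open>w\<close>
  it has the section of the Gibbs density as its density, and Radon-Nikodym derivatives are unique
  almost everywhere.\<close>

lemma AE_cond_distribution_gibbs:
  assumes \<nu>: "\<nu> \<in> admissible P" and eq: "\<nu> = density \<pi> (gibbs V)"
    and V [measurable]: "V \<in> borel_measurable borel" and V_nonneg: "\<And>\<sigma>. 0 \<le> V \<sigma>"
    and V_le: "\<And>\<sigma>. V \<sigma> \<le> b" and cond: "is_cond_distribution \<nu> \<kappa>"
  shows "AE w in P. absolutely_continuous \<alpha> (\<kappa> w) \<and>
    (AE \<sigma> in \<alpha>. RN_deriv \<alpha> (\<kappa> w) \<sigma> = ennreal (exp (w * V \<sigma>) / partition V w))"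
proof -
  note [measurable] = measurable_gibbs[OF V V_nonneg V_le]
  have "AE w in P. \<kappa> w = density \<alpha> (\<lambda>\<sigma>. gibbs V (\<sigma>, w))"
    using marginal_admissible[OF \<nu>] cond gibbs_nonneg[OF V V_nonneg V_le] unfolding eq
    by (intro AE_cond_distribution) auto
  thus ?thesis
    using AE_space
  proof eventually_elim
    case (elim w)
    note [measurable] = elim(2)
    have m: "(\<lambda>\<sigma>. ennreal (gibbs V (\<sigma>, w))) \<in> borel_measurable \<alpha>" by measurable
    have "AE \<sigma> in \<alpha>. ennreal (gibbs V (\<sigma>, w)) = RN_deriv \<alpha> (\<kappa> w) \<sigma>"
      by (rule alpha.RN_deriv_unique[OF m elim(1)[symmetric]])
    hence "AE \<sigma> in \<alpha>. RN_deriv \<alpha> (\<kappa> w) \<sigma> = ennreal (exp (w * V \<sigma>) / partition V w)"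
      by eventually_elim (simp add: gibbs_def)
    thus ?case
      using absolutely_continuousI_density[OF m] elim(1) by simp
  qed
qed

end

section \<open>Passage from the random variable \<open>W\<close> to its law \<open>P\<close>\<close>

theorem theorem4p1:
  fixes \<alpha> :: "'a::polish_space measure"
    and \<Phi> :: "'a \<Rightarrow> 'a \<Rightarrow> real"
    and \<Omega> :: "'b measure"
    and W :: "'b \<Rightarrow> real"
    and P :: "real measure"
    and \<nu> :: "('a \<times> real) measure"
    and \<kappa> :: "real \<Rightarrow> 'a measure"
  assumes compact_E: "compact (UNIV :: 'a set)"
    and alpha: "\<alpha> \<in> borel_prob_measures UNIV"
    and Phi_bounded: "bounded (range (\<lambda>(\<sigma>, \<sigma>'). \<Phi> \<sigma> \<sigma>'))"
    and Phi_measurable: "(\<lambda>(\<sigma>, \<sigma>'). \<Phi> \<sigma> \<sigma>') \<in> borel_measurable borel"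
    and Phi_symmetric: "\<And>\<sigma> \<sigma>'. \<Phi> \<sigma> \<sigma>' = \<Phi> \<sigma>' \<sigma>"
    and Omega: "prob_space \<Omega>"
    and W_measurable: "W \<in> measurable \<Omega> pos_borel"
    and W_law: "P = distr \<Omega> pos_borel W"
    and W_second_moment: "integrable \<Omega> (\<lambda>x. (W x)\<^sup>2)"
    and maximizer: "is_maximizer P \<alpha> (interaction (\<integral>x. W x \<partial>\<Omega>) \<Phi>) \<nu>"
    and kappa: "is_cond_distribution \<nu> \<kappa>"
  shows "\<exists>V :: 'a \<Rightarrow> real. V \<in> borel_measurable borel \<and>
      (AE w in P. absolutely_continuous \<alpha> (\<kappa> w) \<and>
        (AE \<sigma> in \<alpha>. RN_deriv \<alpha> (\<kappa> w) \<sigma> =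
           ennreal (exp (w * V \<sigma>) / (\<integral>\<tau>. exp (w * V \<tau>) \<partial>\<alpha>)))) \<and>
      (\<forall>\<sigma>. V \<sigma> =
         (\<integral>w. (\<integral>\<tau>. exp (\<Phi> \<sigma> \<tau>) * exp (w * V \<tau>) \<partial>\<alpha>) / (\<integral>\<tau>. exp (w * V \<tau>) \<partial>\<alpha>)
            \<partial>size_biased (\<integral>x. W x \<partial>\<Omega>) P))"
proof -
  interpret O: prob_space \<Omega> by fact
  obtain c where c: "\<And>\<sigma> \<sigma>'. \<Phi> \<sigma> \<sigma>' \<le> c"
  proof -
    obtain c where "\<And>x. x \<in> range (\<lambda>(\<sigma>, \<sigma>'). \<Phi> \<sigma> \<sigma>') \<Longrightarrow> \<bar>x\<bar> \<le> c"
      using Phi_bounded unfolding bounded_real by blast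
    hence "\<bar>\<Phi> \<sigma> \<sigma>'\<bar> \<le> c" for \<sigma> \<sigma>' by force
    thus thesis using that abs_le_D1 by blast
  qed
  have W_borel [measurable]: "W \<in> borel_measurable \<Omega>"
    using W_measurable by (simp add: measurable_restrict_space2_iff)
  have W_pos: "W x > 0" if "x \<in> space \<Omega>" for x
    using measurable_space[OF W_measurable that] by (simp add: space_restrict_space)
  have int_W: "integrable \<Omega> W"
  proof (rule Bochner_Integration.integrable_bound)
    show "integrable \<Omega> (\<lambda>x. 1 + (W x)\<^sup>2)" using W_second_moment by simp
    \<comment> \<open>Expanding the square of \<open>\<bar>w\<bar> - 1\<close> shows that the second
      moment controls the first.\<close>
    have "\<bar>w\<bar> \<le> 1 + w\<^sup>2" for w :: real
      using zero_le_power2[of "\<bar>w\<bar> - 1"] zero_le_power2[of w]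
      by (simp add: power2_diff)
    thus "AE x in \<Omega>. norm (W x) \<le> norm (1 + (W x)\<^sup>2)" by simp
  qed measurable
  have W_mean_pos: "(\<integral>x. W x \<partial>\<Omega>) > 0"
  proof -
    have nn: "AE x in \<Omega>. 0 \<le> W x" using W_pos by (auto intro: less_imp_le)
    \<comment> \<open>A vanishing mean of the nonnegative \<open>W\<close> would force
      \<open>W = 0\<close> almost surely, against \<open>W > 0\<close>.\<close>
    have "(\<integral>x. W x \<partial>\<Omega>) \<noteq> 0"
    proof
      assume "(\<integral>x. W x \<partial>\<Omega>) = 0"
      hence "AE x in \<Omega>. W x = 0"
        using integral_nonneg_eq_0_iff_AE[OF int_W nn] by simp
      hence "AE x in \<Omega>. False"
        using AE_space by eventually_elim (use W_pos in force)
      thus False by simp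
    qed
    thus ?thesis using integral_nonneg_AE[OF nn] by simp
  qed
  have id: "(\<lambda>w. w) \<in> borel_measurable pos_borel"
    by (intro measurable_restrict_space1) auto
  interpret weighted_model \<alpha> P \<Phi> c "\<integral>x. W x \<partial>\<Omega>"
  proof (intro weighted_model.intro reference_pair.intro weighted_model_axioms.intro)
    show "prob_space \<alpha>" "sets \<alpha> = sets borel"
      using alpha by (auto simp: borel_prob_measures_def)
    show "prob_space P" "sets P = sets pos_borel"
      using W_measurable by (simp_all add: W_law O.prob_space_distr)
    show "(\<lambda>(\<sigma>, \<sigma>'). \<Phi> \<sigma> \<sigma>') \<in> borel_measurable (borel \<Otimes>\<^sub>M borel)"
      using Phi_measurable by (simp only: borel_prod)
    show "integrable P (\<lambda>w. w)"
      unfolding W_law using int_W by (simp add: integrable_distr_eq[OF W_measurable id])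
    show "(\<integral>w. w \<partial>P) = (\<integral>x. W x \<partial>\<Omega>)"
      unfolding W_law by (rule integral_distr[OF W_measurable id])
  qed (fact c Phi_symmetric W_mean_pos)+
  have \<nu>: "\<nu> \<in> admissible P" using maximizer by (simp add: is_maximizer_def)
  note field = measurable_field[OF \<nu>] field_nonneg[OF \<nu>] field_le[OF \<nu>]
  \<comment> \<open>Here \<open>V\<close> becomes \<open>field \<nu>\<close>: the maximizer is the
    Gibbs measure of its own field, which makes the formula of \<open>field_fixed_point\<close>
    self-consistent.\<close>
  note gibbs = \<nu> maximizer_gibbs[OF maximizer kappa] field
  show ?thesis
    using AE_cond_distribution_gibbs[OF gibbs kappa] field_fixed_point[OF gibbs] field(1)
    unfolding partition_def by blast
qed

end
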